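(* Let $p$ be an odd prime and $\mathbf{C}^{(p)}=(c_i)_{i\ge0}$ the $p$-Cantor sequence over $\mathbb{F}_p$. For each $r\ge0$ let $\widetilde{\mathbf{S}}_r=(x_i)_{-p^r\le i<2p^r}$ with $x_i=c_i$ if $0\le i<p^r$ and $x_i=0$ otherwise, and for $0\le m,n<p^r$ let $W_r[m,n]=\det\big((x_{i-j+n})_{0\le i,j\le m}\big)\in\mathbb{F}_p$. Let \[\mathcal{J}_r=\bigcup_{\substack{0\le m,n<p^r\\ W_r[m,n]\neq0}}\Big[\tfrac{m}{p^r},\tfrac{m+1}{p^r}\Big)\times\Big[\tfrac{n}{p^r},\tfrac{n+1}{p^r}\Big),\qquad \mathcal{F}=\bigcap_{r\ge0}\mathcal{J}_r\subseteq[0,1]^2.\] Then the Hausdorff dimension of $\mathcal{F}$ is $\dfrac{\log\left(\frac{p^2+1}{2}\right)}{\log p}$.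
   Context: $p_2=(p-1)/2$. For real $a,b$, $\binom{a}{b}=\frac{a!}{b!(a-b)!}$ if $a,b$ are nonnegative integers with $a\ge b$, and $0$ otherwise. The $p$-Cantor sequence: let $\phi_p$ be the substitution on $\{0,1,\dots,p-1\}$ (identified with $\mathbb{F}_p$) sending each letter $n$ to the length-$p$ word whose $i$-th letter ($0\le i\le p-1$) is $n\binom{p_2}{i/2}\bmod p$, extended to words by concatenation; $\mathbf{C}^{(p)}=\lim_{k\to\infty}\phi_p^k(1)$. Note that all indices $i-j+n$ appearing in the determinants lie in $[-p^r,2p^r)$. *)

theory Defs
  imports
    "HOL-Analysis.Analysis"
    "HOL-Computational_Algebra.Primes"
    "Jordan_Normal_Form.Determinant"
begin

section \<open>The Cantor sequence\<close>

definition real_binom :: "real \<Rightarrow> real \<Rightarrow> nat" where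
  "real_binom a b =
     (if a \<in> \<nat> \<and> b \<in> \<nat> \<and> a \<ge> b then nat \<lfloor>a\<rfloor> choose nat \<lfloor>b\<rfloor> else 0)"

text \<open>Throughout, the elements of the prime field with \<open>p\<close> elements are represented by the
  integers \<open>0, \<dots>, p - 1\<close>, with arithmetic modulo \<open>p\<close>.\<close>

definition cantor_subst_letter :: "nat \<Rightarrow> int \<Rightarrow> int list" where
  "cantor_subst_letter p n =
     map (\<lambda>i. (n * int (real_binom ((real p - 1) / 2) (real i / 2))) mod int p) [0..<p]"

definition cantor_subst :: "nat \<Rightarrow> int list \<Rightarrow> int list" where
  "cantor_subst p w = concat (map (cantor_subst_letter p) w)"

definition cantor_word :: "nat \<Rightarrow> nat \<Rightarrow> int list" where
  "cantor_word p k = (cantor_subst p ^^ k) [1]"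

text \<open>The limit of the words \<^term>\<open>cantor_word p k\<close>: its \<open>i\<close>-th letter is the letter that
  all but finitely many of them have at position \<open>i\<close>.\<close>

definition cantor_seq :: "nat \<Rightarrow> nat \<Rightarrow> int" where
  "cantor_seq p i =
     (THE c. \<forall>\<^sub>F k in sequentially. i < length (cantor_word p k) \<and> cantor_word p k ! i = c)"

text \<open>For odd \<open>p\<close> the limit exists, since each word is a prefix of the next one.\<close>

lemma length_cantor_word: "length (cantor_word p k) = p ^ k"
proof -
  have *: "length (cantor_subst p w) = p * length w" for w
    by (induction w) (auto simp: cantor_subst_def cantor_subst_letter_def)
  show ?thesis
    by (induction k) (simp_all add: cantor_word_def *)
qed

lemma cantor_word_prefix:
  assumes "odd p" "p > 1"
  shows "\<exists>v. cantor_word p (Suc k) = cantor_word p k @ v"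
proof (induction k)
  case 0
  have "real_binom ((real p - 1) / 2) 0 = 1"
  proof -
    obtain q where "p = 2 * q + 1" using \<open>odd p\<close> by (elim oddE)
    then show ?thesis by (simp add: real_binom_def)
  qed
  then have "hd (cantor_subst_letter p 1) = 1" "cantor_subst_letter p 1 \<noteq> []"
    using \<open>p > 1\<close> by (simp_all add: cantor_subst_letter_def hd_map)
  then obtain v where "cantor_subst_letter p 1 = 1 # v"
    by (metis list.collapse)
  then show ?case
    by (simp add: cantor_word_def cantor_subst_def)
next
  case (Suc k)
  then obtain v where v: "cantor_word p (Suc k) = cantor_word p k @ v" ..
  have step: "cantor_word p (Suc j) = cantor_subst p (cantor_word p j)" for j
    by (simp add: cantor_word_def)
  have "cantor_word p (Suc (Suc k)) = cantor_subst p (cantor_word p k @ v)"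
    by (simp only: step v[symmetric])
  also have "\<dots> = cantor_word p (Suc k) @ cantor_subst p v"
    by (simp add: cantor_subst_def step[of k])
  finally show ?case ..
qed

lemma cantor_seq_eq:
  assumes "odd p" "p > 1" "i < p ^ k"
  shows "cantor_seq p i = cantor_word p k ! i"
proof -
  have len: "i < p ^ l" if "l \<ge> k" for l
    using assms(3) power_increasing[OF that, of p] assms(2) by linarith
  have stable: "cantor_word p l ! i = cantor_word p k ! i" if "l \<ge> k" for l
    using that
  proof (induction l rule: dec_induct)
    case (step l)
    obtain v where "cantor_word p (Suc l) = cantor_word p l @ v"
      using cantor_word_prefix assms by blast
    then show ?case
      using step.IH len[OF step.hyps(1)] by (simp add: nth_append length_cantor_word)
  qed simp
  have *: "\<forall>\<^sub>F l in sequentially.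
      i < length (cantor_word p l) \<and> cantor_word p l ! i = cantor_word p k ! i"
    unfolding eventually_sequentially length_cantor_word using stable len by blast
  show ?thesis
    unfolding cantor_seq_def
  proof (rule the_equality)
    fix c
    assume "\<forall>\<^sub>F l in sequentially. i < length (cantor_word p l) \<and> cantor_word p l ! i = c"
    with * have "\<forall>\<^sub>F l in sequentially. c = cantor_word p k ! i"
      by eventually_elim blast
    then show "c = cantor_word p k ! i"
      by (simp only: eventually_const_iff trivial_limit_sequentially simp_thms)
  qed (fact *)
qed


section \<open>The number wall and the limit set\<close>

text \<open>The truncated sequence is only ever used at indices in \<open>[-p\<^sup>r, 2p\<^sup>r)\<close>.\<close>

definition cantor_trunc :: "nat \<Rightarrow> nat \<Rightarrow> int \<Rightarrow> int" where
  "cantor_trunc p r i = (if 0 \<le> i \<and> i < int p ^ r then cantor_seq p (nat i) else 0)"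

text \<open>The determinant over the prime field, as the residue modulo \<open>p\<close> of the determinant of
  the matrix of representatives.\<close>

definition cantor_wall :: "nat \<Rightarrow> nat \<Rightarrow> nat \<Rightarrow> nat \<Rightarrow> int" where
  "cantor_wall p r m n =
     Determinant.det (Matrix.mat (m + 1) (m + 1)
       (\<lambda>(i, j). cantor_trunc p r (int i - int j + int n))) mod int p"

definition cantor_J :: "nat \<Rightarrow> nat \<Rightarrow> (real \<times> real) set" where
  "cantor_J p r =
     (\<Union>(m, n) \<in> {(m, n). m < p ^ r \<and> n < p ^ r \<and> cantor_wall p r m n \<noteq> 0}.
        {real m / real p ^ r ..< (real m + 1) / real p ^ r} \<times>
        {real n / real p ^ r ..< (real n + 1) / real p ^ r})"

definition cantor_F :: "nat \<Rightarrow> (real \<times> real) set" where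
  "cantor_F p = (\<Inter>r. cantor_J p r)"


section \<open>Hausdorff dimension\<close>

text \<open>The \<open>s\<close>-th power of the diameter, with the usual conventions for \<open>s = 0\<close>: the empty set
  contributes 0 and every other set contributes 1, whereas \<^term>\<open>0 powr 0 = (0::real)\<close>.\<close>

definition hausdorff_gauge :: "real \<Rightarrow> 'a::metric_space set \<Rightarrow> ennreal" where
  "hausdorff_gauge s U =
     (if U = {} then 0 else if s = 0 then 1 else ennreal (diameter U powr s))"

text \<open>Boundedness is required explicitly because \<^const>\<open>diameter\<close> is unspecified on unbounded
  sets. Covers by finitely many sets are included, as the \<open>U i\<close> may be empty.\<close>

definition hausdorff_premeasure :: "real \<Rightarrow> real \<Rightarrow> 'a::metric_space set \<Rightarrow> ennreal" where
  "hausdorff_premeasure s \<delta> A =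
     (INF U \<in> {U :: nat \<Rightarrow> 'a set. A \<subseteq> (\<Union>i. U i) \<and> (\<forall>i. bounded (U i) \<and> diameter (U i) \<le> \<delta>)}.
        (\<Sum>i. hausdorff_gauge s (U i)))"

definition hausdorff_measure :: "real \<Rightarrow> 'a::metric_space set \<Rightarrow> ennreal" where
  "hausdorff_measure s A = (SUP \<delta> \<in> {0<..}. hausdorff_premeasure s \<delta> A)"

definition hausdorff_dim :: "'a::metric_space set \<Rightarrow> ereal" where
  "hausdorff_dim A = Inf {ereal s | s. 0 \<le> s \<and> hausdorff_measure s A = 0}"

end

theory Submission
  imports Defs "HOL-Number_Theory.Cong"
begin

text \<open>Put \<open>N = (p\<^sup>r - 1)/2\<close>. By Lucas' theorem the first \<open>p\<^sup>r\<close> terms of the Cantor sequence are the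
  coefficients of \<open>(1 + t\<^sup>2)\<^sup>N\<close> modulo \<open>p\<close>, so after sorting rows and columns by parity every entry of
  the wall is, up to sign, a product of two determinants of the form
  \<open>det (N choose (a + i - j))\<^bsub>i,j<k\<^esub>\<close>. MacMahon's product formula and Legendre's formula give their
  \<open>p\<close>-adic valuations as sums over \<open>s < r\<close> of nonnegative terms, and the term for \<open>q = p\<^sup>s\<close> depends only
  on \<open>k\<close> and \<open>a\<close> modulo \<open>q\<close>. Away from the edges of the \<open>q\<close>-squares it vanishes exactly when
  \<open>\<lfloor>m/q\<rfloor>\<close> and \<open>\<lfloor>n/q\<rfloor>\<close> have the same parity. Hence, up to countably many segments, the limit set consists
  of the points \<open>(x, y)\<close> whose base-\<open>p\<close> digits have equal parity at every position. There are
  \<open>K = (p\<^sup>2 + 1)/2\<close> such pairs of digits. Covering by squares of side \<open>p\<^bsup>-u\<^esup>\<close> gives the upper bound; for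
  the lower bound the pairs are read as base-\<open>K\<close> digits and Lebesgue measure on \<open>[0, 1)\<close> is transported.
  The segments are negligible because the dimension exceeds 1.\<close>

section \<open>Toeplitz determinants\<close>

abbreviation toeplitz :: "nat \<Rightarrow> (int \<Rightarrow> int) \<Rightarrow> int mat" where
  "toeplitz n f \<equiv> Matrix.mat n n (\<lambda>(i, j). f (int i - int j))"

lemma det_mat_leibniz:
  "Determinant.det (Matrix.mat n n f) =
     (\<Sum>\<pi> | \<pi> permutes {0..<n}. signof \<pi> * (\<Prod>i = 0..<n. f (i, \<pi> i)))"
proof -
  have "(\<Prod>i = 0..<n. Matrix.mat n n f $$ (i, \<pi> i)) = (\<Prod>i = 0..<n. f (i, \<pi> i))"
    if "\<pi> permutes {0..<n}" for \<pi>
    using permutes_in_image[OF that] by (intro prod.cong) auto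
  then show ?thesis
    by (subst det_def'[of _ n]) auto
qed

lemma det_mat_cong_mod:
  fixes f g :: "nat \<times> nat \<Rightarrow> int"
  assumes "\<And>i j. i < n \<Longrightarrow> j < n \<Longrightarrow> [f (i, j) = g (i, j)] (mod q)"
  shows "[Determinant.det (Matrix.mat n n f) = Determinant.det (Matrix.mat n n g)] (mod q)"
  unfolding det_mat_leibniz
proof (intro cong_sum cong_mult cong_prod cong_refl)
  fix \<pi> i assume "\<pi> \<in> {\<pi>. \<pi> permutes {0..<n}}" "i \<in> {0..<n}"
  then show "[f (i, \<pi> i) = g (i, \<pi> i)] (mod q)"
    using assms permutes_in_image[of \<pi> "{0..<n}" i] by auto
qed

lemma det_mat_scale:
  fixes f :: "nat \<times> nat \<Rightarrow> int"
  shows "Determinant.det (Matrix.mat n n (\<lambda>(i, j). u i * f (i, j) * v j)) =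
     (\<Prod>i<n. u i) * (\<Prod>j<n. v j) * Determinant.det (Matrix.mat n n f)"
proof -
  have "(\<Prod>i = 0..<n. u i * f (i, \<pi> i) * v (\<pi> i)) =
      (\<Prod>i<n. u i) * (\<Prod>j<n. v j) * (\<Prod>i = 0..<n. f (i, \<pi> i))"
    if "\<pi> permutes {0..<n}" for \<pi>
    using prod.permute[OF that, of v] by (simp add: prod.distrib atLeast0LessThan comp_def)
  then show ?thesis
    unfolding det_mat_leibniz sum_distrib_left by (intro sum.cong) auto
qed

text \<open>Absolute values discard the signs of the permutations; later only divisibility by
  \<open>p\<close> matters.\<close>

lemma abs_det_mat_permute:
  fixes f :: "nat \<times> nat \<Rightarrow> int"
  assumes "\<sigma> permutes {0..<n}" "\<tau> permutes {0..<n}"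
  shows "\<bar>Determinant.det (Matrix.mat n n (\<lambda>(i, j). f (\<sigma> i, \<tau> j)))\<bar> =
     \<bar>Determinant.det (Matrix.mat n n f)\<bar>"
proof -
  have rows: "\<bar>Determinant.det (Matrix.mat n n (\<lambda>(i, j). g (\<rho> i, j)))\<bar> =
     \<bar>Determinant.det (Matrix.mat n n g)\<bar>"
    if "\<rho> permutes {0..<n}" for \<rho> and g :: "nat \<times> nat \<Rightarrow> int"
  proof -
    have "Matrix.mat n n (\<lambda>(i, j). g (\<rho> i, j)) =
        Matrix.mat n n (\<lambda>(i, j). Matrix.mat n n g $$ (\<rho> i, j))"
      using permutes_in_image[OF that] by (intro eq_matI) auto
    then have "Determinant.det (Matrix.mat n n (\<lambda>(i, j). g (\<rho> i, j))) =
        signof \<rho> * Determinant.det (Matrix.mat n n g)"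
      using det_permute_rows[OF mat_carrier that, of g] by simp
    then show ?thesis
      by (simp add: abs_mult sign_def)
  qed
  have transp: "Determinant.det (Matrix.mat n n (\<lambda>(i, j). g (j, i))) =
     Determinant.det (Matrix.mat n n g)" for g :: "nat \<times> nat \<Rightarrow> int"
  proof -
    have "Matrix.mat n n (\<lambda>(i, j). g (j, i)) = transpose_mat (Matrix.mat n n g)"
      by (intro eq_matI) auto
    then show ?thesis
      using det_transpose[OF mat_carrier] by metis
  qed
  have "\<bar>Determinant.det (Matrix.mat n n (\<lambda>(i, j). f (\<sigma> i, \<tau> j)))\<bar> =
      \<bar>Determinant.det (Matrix.mat n n (\<lambda>(i, j). f (i, \<tau> j)))\<bar>"
    using rows[OF assms(1), of "\<lambda>(i, j). f (i, \<tau> j)"] by simp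
  also have "\<dots> = \<bar>Determinant.det (Matrix.mat n n (\<lambda>(i, j). f (j, \<tau> i)))\<bar>"
    using transp[of "\<lambda>(i, j). f (i, \<tau> j)"] by simp
  also have "\<dots> = \<bar>Determinant.det (Matrix.mat n n (\<lambda>(i, j). f (j, i)))\<bar>"
    using rows[OF assms(2), of "\<lambda>(i, j). f (j, i)"] by simp
  also have "\<dots> = \<bar>Determinant.det (Matrix.mat n n f)\<bar>"
    using transp[of f] by simp
  finally show ?thesis .
qed

text \<open>Entries between indices of different parity vanish, so listing the even indices before
  the odd ones, in rows and columns alike, makes the matrix block diagonal.\<close>

lemma toeplitz_even_support:
  assumes f: "\<And>z. odd z \<Longrightarrow> f z = 0"
  shows "\<bar>Determinant.det (toeplitz n f)\<bar> =
     \<bar>Determinant.det (toeplitz ((n + 1) div 2) (\<lambda>z. f (2 * z))) *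
      Determinant.det (toeplitz (n div 2) (\<lambda>z. f (2 * z)))\<bar>"
proof -
  define h where "h = (n + 1) div 2"
  \<comment> \<open>\<open>h\<close> is the number of even indices below \<open>n\<close>; the
    identity from \<open>n\<close> on is what \<open>permutes\<close> demands.\<close>
  define \<sigma> where "\<sigma> i = (if i < h then 2 * i else if i < n then 2 * (i - h) + 1 else i)" for i
  have "bij_betw \<sigma> {0..<n} {0..<n}"
    by (rule bij_betwI[where g = "\<lambda>i. if even i then i div 2 else h + i div 2"])
      (auto simp: \<sigma>_def h_def elim!: evenE oddE)
  then have \<sigma>: "\<sigma> permutes {0..<n}"
    by (rule bij_imp_permutes) (auto simp: \<sigma>_def h_def)
  have "Matrix.mat n n (\<lambda>(i, j). f (int (\<sigma> i) - int (\<sigma> j))) =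
      four_block_mat (toeplitz h (\<lambda>z. f (2 * z))) (0\<^sub>m h (n div 2)) (0\<^sub>m (n div 2) h)
        (toeplitz (n div 2) (\<lambda>z. f (2 * z)))" (is "?L = ?R")
  proof (rule eq_matI)
    show "dim_row ?L = dim_row ?R" "dim_col ?L = dim_col ?R"
      by (auto simp: h_def)
    fix i j assume "i < dim_row ?R" "j < dim_col ?R"
    then have "i < n" "j < n" "h + n div 2 = n" by (auto simp: h_def)
    then show "?L $$ (i, j) = ?R $$ (i, j)"
      by (auto simp: \<sigma>_def algebra_simps intro!: f)
  qed
  then show ?thesis
    using abs_det_mat_permute[OF \<sigma> \<sigma>, of "\<lambda>(i, j). f (int i - int j)"]
    unfolding h_def[symmetric] by (simp add: det_four_block_mat_upper_right_zero[of _ h _ "n div 2"])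
qed

text \<open>Now entries between indices of equal parity vanish. Rows are sorted with even indices
  first and columns with odd indices first; the even size makes both diagonal blocks square.\<close>

lemma toeplitz_odd_support:
  assumes f: "\<And>z. even z \<Longrightarrow> f z = 0"
  shows "\<bar>Determinant.det (toeplitz (2 * k) f)\<bar> =
     \<bar>Determinant.det (toeplitz k (\<lambda>z. f (2 * z - 1))) *
      Determinant.det (toeplitz k (\<lambda>z. f (2 * z + 1)))\<bar>"
proof -
  define \<sigma> where "\<sigma> i = (if i < k then 2 * i else if i < 2 * k then 2 * (i - k) + 1 else i)" for i
  define \<tau> where "\<tau> i = (if i < k then 2 * i + 1 else if i < 2 * k then 2 * (i - k) else i)" for i
  have "bij_betw \<sigma> {0..<2*k} {0..<2*k}"
    by (rule bij_betwI[where g = "\<lambda>i. if even i then i div 2 else k + i div 2"])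
      (auto simp: \<sigma>_def elim!: evenE oddE)
  then have \<sigma>: "\<sigma> permutes {0..<2*k}"
    by (rule bij_imp_permutes) (auto simp: \<sigma>_def)
  have "bij_betw \<tau> {0..<2*k} {0..<2*k}"
    by (rule bij_betwI[where g = "\<lambda>i. if odd i then i div 2 else k + i div 2"])
      (auto simp: \<tau>_def elim!: evenE oddE)
  then have \<tau>: "\<tau> permutes {0..<2*k}"
    by (rule bij_imp_permutes) (auto simp: \<tau>_def)
  have "Matrix.mat (2*k) (2*k) (\<lambda>(i, j). f (int (\<sigma> i) - int (\<tau> j))) =
      four_block_mat (toeplitz k (\<lambda>z. f (2 * z - 1))) (0\<^sub>m k k) (0\<^sub>m k k)
        (toeplitz k (\<lambda>z. f (2 * z + 1)))" (is "?L = ?R")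
  proof (rule eq_matI)
    fix i j assume "i < dim_row ?R" "j < dim_col ?R"
    then show "?L $$ (i, j) = ?R $$ (i, j)"
      by (auto simp: \<sigma>_def \<tau>_def algebra_simps intro!: f)
  qed auto
  then show ?thesis
    using abs_det_mat_permute[OF \<sigma> \<tau>, of "\<lambda>(i, j). f (int i - int j)"]
    by (simp add: det_four_block_mat_upper_right_zero[of _ k _ k])
qed

text \<open>A permutation of \<open>{0..2k}\<close> cannot map the \<open>k + 1\<close> even numbers into the \<open>k\<close> odd ones, so
  every term of the Leibniz expansion has a factor on the zero diagonals.\<close>

lemma toeplitz_odd_support_odd_size:
  assumes f: "\<And>z. even z \<Longrightarrow> f z = 0"
  shows "Determinant.det (toeplitz (2 * k + 1) f) = 0"
  unfolding det_mat_leibniz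
proof (intro sum.neutral ballI)
  fix \<pi> assume "\<pi> \<in> {\<pi>. \<pi> permutes {0..<2 * k + 1}}"
  then have \<pi>: "\<pi> permutes {0..<2 * k + 1}" by simp
  have "\<exists>i\<in>{0..<2 * k + 1}. even (int i - int (\<pi> i))"
  proof (rule ccontr)
    assume *: "\<not> ?thesis"
    have "\<pi> ` (\<lambda>i. 2 * i) ` {..k} \<subseteq> (\<lambda>i. 2 * i + 1) ` {..<k}"
    proof clarify
      fix i assume "i \<le> k"
      then have "2 * i \<in> {0..<2 * k + 1}" by auto
      then have "odd (int (2 * i) - int (\<pi> (2 * i)))" "\<pi> (2 * i) < 2 * k + 1"
        using * permutes_in_image[OF \<pi>, of "2 * i"] by (blast, auto)
      then have "odd (\<pi> (2 * i))" "\<pi> (2 * i) < 2 * k + 1" by auto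
      then show "\<pi> (2 * i) \<in> (\<lambda>i. 2 * i + 1) ` {..<k}"
        by (elim oddE) auto
    qed
    then have "card (\<pi> ` (\<lambda>i. 2 * i) ` {..k}) \<le> card ((\<lambda>i. 2 * i + 1) ` {..<k})"
      by (intro card_mono) auto
    also have "\<dots> \<le> k" using card_image_le[of "{..<k}"] by simp
    also have "card (\<pi> ` (\<lambda>i. 2 * i) ` {..k}) = k + 1"
      using permutes_inj[OF \<pi>] by (simp add: card_image inj_on_def)
    finally show False by simp
  qed
  then have "(\<Prod>i = 0..<2 * k + 1. f (int i - int (\<pi> i))) = 0"
    using f by (intro prod_zero) blast+
  then show "signof \<pi> * (\<Prod>i = 0..<2 * k + 1. case (i, \<pi> i) of (i, j) \<Rightarrow> f (int i - int j)) = 0"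
    by simp
qed

section \<open>Binomial determinants and MacMahon's product formula\<close>

text \<open>The guard is there because \<open>nat\<close> would send negative arguments to 0, where
  the binomial coefficient is 1.\<close>

definition binom_int :: "nat \<Rightarrow> int \<Rightarrow> int" where
  "binom_int N z = (if z < 0 then 0 else int (N choose nat z))"

abbreviation binom_det :: "nat \<Rightarrow> nat \<Rightarrow> nat \<Rightarrow> int" where
  "binom_det N k a \<equiv> Determinant.det (toeplitz k (\<lambda>z. binom_int N (z + int a)))"

lemma binom_int_vandermonde:
  "binom_int (N + t) z = (\<Sum>l\<le>t. int (t choose l) * binom_int N (z - int l))"
proof (cases "z < 0")
  case False
  then obtain r where z: "z = int r" by (metis nonneg_int_cases linorder_not_less)
  have "(\<Sum>l\<le>t. int (t choose l) * binom_int N (z - int l)) =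
      (\<Sum>l\<in>{..t} \<inter> {..r}. int (t choose l) * int (N choose (r - l)))"
    by (intro sum.mono_neutral_cong_right) (auto simp: z binom_int_def nat_diff_distrib)
  also have "\<dots> = (\<Sum>l\<le>r. int (t choose l) * int (N choose (r - l)))"
    by (intro sum.mono_neutral_left) (auto simp: binomial_eq_0)
  also have "\<dots> = int ((t + N) choose r)"
    by (simp flip: vandermonde)
  finally show ?thesis by (simp add: z binom_int_def add.commute)
qed (simp add: binom_int_def)

lemma det_unitriangular:
  fixes A :: "int mat"
  assumes "A \<in> carrier_mat n n" "\<And>i. i < n \<Longrightarrow> A $$ (i, i) = 1"
    and "(\<forall>i j. i < j \<longrightarrow> j < n \<longrightarrow> A $$ (i, j) = 0) \<or> (\<forall>i j. j < i \<longrightarrow> i < n \<longrightarrow> A $$ (i, j) = 0)"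
  shows "Determinant.det A = 1"
proof -
  have "Determinant.det A = prod_list (diag_mat A)"
    using assms(3)
  proof
    assume "\<forall>i j. i < j \<longrightarrow> j < n \<longrightarrow> A $$ (i, j) = 0"
    then show ?thesis using det_lower_triangular assms(1) by blast
  next
    assume "\<forall>i j. j < i \<longrightarrow> i < n \<longrightarrow> A $$ (i, j) = 0"
    then show ?thesis using det_upper_triangular[OF _ assms(1)] assms(1) by (auto simp: upper_triangular_def)
  qed
  also have "diag_mat A = replicate n 1"
    using assms(1,2) by (intro nth_equalityI) (auto simp: diag_mat_def)
  finally show ?thesis by simp
qed

text \<open>By Vandermonde's convolution, column operations replace the upper entry \<open>N\<close> in column \<open>j\<close>
  by \<open>N + k - 1 - j\<close>.\<close>

lemma binom_det_column_ops:
  "binom_det N k a =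
     Determinant.det (Matrix.mat k k (\<lambda>(i, j). binom_int (N + (k - 1 - j)) (int i - int j + int a)))"
proof -
  let ?A = "toeplitz k (\<lambda>z. binom_int N (z + int a))"
  \<comment> \<open>Right multiplication by the unitriangular \<open>?L\<close> adds to column
    \<open>j\<close> the later columns \<open>l\<close> with weights
    \<open>(k - 1 - j) choose (l - j)\<close>.\<close>
  let ?L = "Matrix.mat k k (\<lambda>(l, j). if l < j then 0 else int ((k - 1 - j) choose (l - j)))"
  let ?B = "Matrix.mat k k (\<lambda>(i, j). binom_int (N + (k - 1 - j)) (int i - int j + int a))"
  have "?B = ?A * ?L"
  proof (rule eq_matI)
    fix i j assume "i < dim_row (?A * ?L)" "j < dim_col (?A * ?L)"
    then have ij: "i < k" "j < k" by auto
    have "(?A * ?L) $$ (i, j) =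
        (\<Sum>l<k. binom_int N (int i - int l + int a) *
          (if l < j then 0 else int ((k - 1 - j) choose (l - j))))"
      using ij by (simp add: scalar_prod_def atLeast0LessThan)
    also have "\<dots> = (\<Sum>l\<in>{j..<k}. int ((k - 1 - j) choose (l - j)) * binom_int N (int i - int l + int a))"
      by (intro sum.mono_neutral_cong_right) auto
    also have "\<dots> = (\<Sum>l\<le>k - 1 - j. int ((k - 1 - j) choose l) * binom_int N (int i - int j + int a - int l))"
      by (rule sum.reindex_bij_witness[where i = "\<lambda>l. l + j" and j = "\<lambda>l. l - j"])
        (use ij in \<open>auto simp: of_nat_diff algebra_simps\<close>)
    also have "\<dots> = ?B $$ (i, j)"
      using ij by (simp add: binom_int_vandermonde)
    finally show "?B $$ (i, j) = (?A * ?L) $$ (i, j)" by simp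
  qed auto
  moreover have "Determinant.det ?L = 1"
    by (rule det_unitriangular[of _ k]) auto
  ultimately show ?thesis
    by (simp add: det_mult[of _ k])
qed

text \<open>Vandermonde's convolution factors the matrix into a lower and an upper unitriangular
  matrix of binomial coefficients.\<close>

lemma det_binom_add: "Determinant.det (Matrix.mat k k (\<lambda>(i, j). int ((a + i) choose j))) = 1"
proof -
  let ?P = "Matrix.mat k k (\<lambda>(i, l). int (i choose l))"
  let ?Q = "Matrix.mat k k (\<lambda>(l, j). if j < l then 0 else int (a choose (j - l)))"
  have "Matrix.mat k k (\<lambda>(i, j). int ((a + i) choose j)) = ?P * ?Q" (is "?M = _")
  proof (rule eq_matI)
    fix i j assume "i < dim_row (?P * ?Q)" "j < dim_col (?P * ?Q)"
    then have ij: "i < k" "j < k" by auto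
    have "(?P * ?Q) $$ (i, j) =
        (\<Sum>l<k. int (i choose l) * (if j < l then 0 else int (a choose (j - l))))"
      using ij by (simp add: scalar_prod_def atLeast0LessThan)
    also have "\<dots> = (\<Sum>l\<le>j. int (i choose l) * int (a choose (j - l)))"
      using ij by (intro sum.mono_neutral_cong_right) auto
    also have "\<dots> = int ((i + a) choose j)"
      by (simp flip: vandermonde)
    finally show "?M $$ (i, j) = (?P * ?Q) $$ (i, j)"
      using ij by (simp add: add.commute)
  qed auto
  moreover have "Determinant.det ?P = 1" "Determinant.det ?Q = 1"
    by (auto intro!: det_unitriangular[of _ k])
  ultimately show ?thesis
    by (simp add: det_mult[of _ k])
qed

text \<open>MacMahon's formula, cleared of denominators. After the column operations each entry is
  \<open>(a + i) choose j\<close> times a factor depending on the row and one depending on the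
  column, and the remaining matrix has determinant 1.\<close>

lemma binom_det_fact:
  assumes "a \<le> N"
  shows "(\<Prod>i<k. fact (a + i) * fact (N - a + i)) * binom_det N k a = (\<Prod>j<k. fact (N + j) * fact j)"
proof -
  \<comment> \<open>The factors 1 match the shape \<open>u i * f (i, j) * v j\<close> of
    \<open>det_mat_scale\<close>. For \<open>j > a + i\<close> both sides are 0.\<close>
  have entry: "fact (a + i) * fact (N - a + (k - 1 - i)) *
        binom_int (N + (k - 1 - j)) (int i - int j + int a) * 1 =
      1 * int ((a + i) choose j) * (fact (N + (k - 1 - j)) * fact j)"
    if "i < k" "j < k" for i j
  proof (cases "j \<le> a + i")
    case True
    then have z: "nat (int i - int j + int a) = a + i - j" "\<not> int i - int j + int a < 0" by auto
    have le: "a + i - j \<le> N + (k - 1 - j)" using that assms by auto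
    have c: "N + (k - 1 - j) - (a + i - j) = N - a + (k - 1 - i)" using that assms True by auto
    have H: "fact (a + i - j) * fact (N - a + (k - 1 - i)) * ((N + (k - 1 - j)) choose (a + i - j)) =
        (fact (N + (k - 1 - j)) :: nat)"
      using binomial_fact_lemma[OF le] c by simp
    have A: "fact j * fact (a + i - j) * ((a + i) choose j) = (fact (a + i) :: nat)"
      by (rule binomial_fact_lemma[OF True])
    have "fact (a + i) * fact (N - a + (k - 1 - i)) * ((N + (k - 1 - j)) choose (a + i - j)) =
        ((a + i) choose j) * (fact (N + (k - 1 - j)) * fact j :: nat)"
      unfolding A[symmetric] H[symmetric] by (simp only: mult_ac)
    from arg_cong[OF this, of int] show ?thesis
      by (simp add: binom_int_def z)
  qed (auto simp: binom_int_def)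
  let ?B = "\<lambda>(i, j). binom_int (N + (k - 1 - j)) (int i - int j + int a)"
  let ?C = "\<lambda>(i, j). int ((a + i) choose j)"
  \<comment> \<open>The reversed indices left by the column operations are turned back inside the
    products.\<close>
  have rev: "(\<Prod>i<k. fact (M + (k - 1 - i))) = (\<Prod>i<k. fact (M + i) :: int)" for M
    by (subst (2) prod.nat_diff_reindex[symmetric]) simp
  have "(\<Prod>i<k. fact (a + i) * fact (N - a + (k - 1 - i))) * (\<Prod>j<k. 1) * Determinant.det (Matrix.mat k k ?B) =
      (\<Prod>i<k. 1) * (\<Prod>j<k. fact (N + (k - 1 - j)) * fact j) * Determinant.det (Matrix.mat k k ?C)"
    unfolding det_mat_scale[symmetric]
    by (intro arg_cong[of _ _ Determinant.det] eq_matI) (use entry in auto)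
  then show ?thesis
    by (simp only: binom_det_column_ops det_binom_add prod.distrib rev prod.neutral_const
        mult_1_left mult_1_right)
qed

section \<open>Arithmetic of the determinants\<close>

text \<open>Modulo \<open>p\<close>, \<open>(1 + t)^(n + p)\<close> equals
  \<open>(1 + t)^n * (1 + t^p)\<close>; the claim compares coefficients of
  \<open>t^j\<close>.\<close>

lemma choose_prime_add_cong:
  assumes "prime (p :: nat)"
  shows "[(n + p) choose j = (n choose j) + (if p \<le> j then n choose (j - p) else 0)] (mod p)"
proof -
  have "(n + p) choose j = (\<Sum>k\<le>j. (p choose k) * (n choose (j - k)))"
    by (simp add: vandermonde add.commute)
  also have "[\<dots> = (\<Sum>k\<le>j. if k = 0 then n choose j else if k = p then n choose (j - p) else 0)] (mod p)"
  proof (rule cong_sum)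
    fix k
    have "p dvd p choose k" if "k \<noteq> 0" "k \<noteq> p"
      using that assms by (cases k p rule: linorder_cases) (auto simp: binomial_eq_0 dvd_choose_prime)
    moreover have "p \<noteq> 0" using assms by auto
    ultimately show "[(p choose k) * (n choose (j - k)) =
        (if k = 0 then n choose j else if k = p then n choose (j - p) else 0)] (mod p)"
      by (auto simp: cong_0_iff)
  qed
  also have "(\<Sum>k\<le>j. if k = 0 then n choose j else if k = p then n choose (j - p) else 0) =
      (\<Sum>k\<le>j. (if k = 0 then n choose j else 0) + (if k = p then n choose (j - p) else 0))"
    using assms by (intro sum.cong) auto
  also have "\<dots> = (n choose j) + (if p \<le> j then n choose (j - p) else 0)"
    by (subst sum.distrib) simp
  finally show ?thesis .
qed

text \<open>Adding \<open>p\<close> to the upper entry acts on the quotients \<open>a\<close> and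
  \<open>c\<close> as Pascal's rule, so induction on \<open>a\<close> splits off one digit as in
  Lucas' theorem.\<close>

lemma lucas_digit:
  assumes "prime (p :: nat)" "b < p" "d < p"
  shows "[(p * a + b) choose (p * c + d) = (a choose c) * (b choose d)] (mod p)"
proof (induction a arbitrary: c)
  case 0
  then show ?case
    using assms by (cases c) (auto simp: binomial_eq_0)
next
  case (Suc a)
  have "[(p * a + b + p) choose (p * c + d) = ((p * a + b) choose (p * c + d)) +
      (if p \<le> p * c + d then (p * a + b) choose (p * c + d - p) else 0)] (mod p)"
    by (rule choose_prime_add_cong) fact
  also have "[((p * a + b) choose (p * c + d)) +
      (if p \<le> p * c + d then (p * a + b) choose (p * c + d - p) else 0) =
      (a choose c) * (b choose d) + (if c = 0 then 0 else (a choose (c - 1)) * (b choose d))] (mod p)"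
  proof (rule cong_add[OF Suc.IH])
    show "[(if p \<le> p * c + d then (p * a + b) choose (p * c + d - p) else 0) =
        (if c = 0 then 0 else (a choose (c - 1)) * (b choose d))] (mod p)"
    proof (cases c)
      case (Suc c')
      then show ?thesis using Suc.IH[of c'] by (simp add: algebra_simps)
    qed (use assms in auto)
  qed
  also have "(a choose c) * (b choose d) + (if c = 0 then 0 else (a choose (c - 1)) * (b choose d)) =
      (Suc a choose c) * (b choose d)"
    by (cases c) (auto simp: algebra_simps)
  finally show ?case by (simp add: algebra_simps)
qed

section \<open>The Cantor sequence modulo p\<close>

lemma real_binom_half:
  assumes "odd p"
  shows "real_binom ((real p - 1) / 2) (real i / 2) =
     (if even i then ((p - 1) div 2) choose (i div 2) else 0)"
proof -
  obtain h where p: "p = 2 * h + 1" using assms by (elim oddE)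
  have h: "(real p - 1) / 2 = real h" by (simp add: p)
  show ?thesis
  proof (cases "even i")
    case True
    then obtain l where "i = 2 * l" by (elim evenE)
    then show ?thesis by (simp add: h real_binom_def p binomial_eq_0)
  next
    case False
    have "real i / 2 \<notin> \<nat>"
    proof
      assume "real i / 2 \<in> \<nat>"
      then obtain l where "real i / 2 = real l" by (elim Nats_cases)
      then have "real i = real (2 * l)" by simp
      then have "i = 2 * l" by (simp only: of_nat_eq_iff)
      with False show False by simp
    qed
    with False show ?thesis by (simp add: real_binom_def)
  qed
qed

lemma nth_concat_map_uniform:
  assumes "\<And>x. length (f x) = p" "i < p * length w"
  shows "concat (map f w) ! i = f (w ! (i div p)) ! (i mod p)"
  using assms(2)
proof (induction w arbitrary: i)
  case (Cons x w)
  then have "p > 0" by (cases p) auto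
  show ?case
  proof (cases "i < p")
    case False
    with Cons \<open>p > 0\<close> have "concat (map f w) ! (i - p) = f (w ! ((i - p) div p)) ! ((i - p) mod p)"
      by (intro Cons.IH) (auto simp: algebra_simps)
    with False \<open>p > 0\<close> show ?thesis
      by (simp add: nth_append assms(1) le_div_geq le_mod_geq nth_Cons')
  qed (simp add: nth_append assms(1))
qed simp

text \<open>The word \<open>\<phi>\<^sub>p\<^sup>r(1)\<close> lists the coefficients of \<open>(1 + t\<^sup>2)\<^bsup>(p\<^sup>r - 1)/2\<^esup>\<close>.\<close>

lemma cantor_word_cong:
  assumes "prime p" "odd p" "i < p ^ r"
  shows "[cantor_word p r ! i =
     (if even i then int (((p ^ r - 1) div 2) choose (i div 2)) else 0)] (mod int p)"
  using assms(3)
proof (induction r arbitrary: i)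
  case 0
  then show ?case by (simp add: cantor_word_def)
next
  case (Suc r)
  obtain h where p: "p = 2 * h + 1" using assms by (elim oddE)
  obtain g where g: "p ^ r = 2 * g + 1" using assms by (metis even_power oddE)
  then have gdiv: "(p ^ r - 1) div 2 = g" by simp
  \<comment> \<open>So \<open>h\<close> is the last base-\<open>p\<close> digit of
    \<open>(p ^ Suc r - 1) div 2\<close> and the remaining digits form \<open>g\<close>, as Lucas'
    theorem requires.\<close>
  have G: "(p ^ Suc r - 1) div 2 = p * g + h"
    unfolding power_Suc g by (simp add: p algebra_simps)
  have "p > 0" using p by simp
  then have i1: "i div p < p ^ r"
    using Suc.prems by (simp add: less_mult_imp_div_less mult.commute)
  have im: "i mod p < p" using \<open>p > 0\<close> by simp
  let ?c = "\<lambda>i. if even i then int (h choose (i div 2)) else 0"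
  have "cantor_word p (Suc r) ! i = concat (map (cantor_subst_letter p) (cantor_word p r)) ! i"
    by (simp add: cantor_word_def cantor_subst_def)
  also have "\<dots> = cantor_subst_letter p (cantor_word p r ! (i div p)) ! (i mod p)"
    by (rule nth_concat_map_uniform)
      (use Suc.prems in \<open>auto simp: cantor_subst_letter_def length_cantor_word\<close>)
  also have "\<dots> = (cantor_word p r ! (i div p) * ?c (i mod p)) mod int p"
    using im by (simp add: cantor_subst_letter_def real_binom_half[OF assms(2)]) (simp add: p)
  finally have "[cantor_word p (Suc r) ! i = cantor_word p r ! (i div p) * ?c (i mod p)] (mod int p)"
    by simp
  also have "[cantor_word p r ! (i div p) * ?c (i mod p) =
      (if even (i div p) then int (g choose (i div p div 2)) else 0) * ?c (i mod p)] (mod int p)"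
    using Suc.IH[OF i1] unfolding gdiv by (rule cong_mult[OF _ cong_refl])
  also have "[(if even (i div p) then int (g choose (i div p div 2)) else 0) * ?c (i mod p) =
      (if even i then int ((p * g + h) choose (i div 2)) else 0)] (mod int p)"
  proof -
    have lucas: "[int ((p * g + h) choose (p * c + d)) = int (g choose c) * int (h choose d)] (mod int p)"
      if "d < p" for c d
    proof -
      have "[(p * g + h) choose (p * c + d) = (g choose c) * (h choose d)] (mod p)"
        using lucas_digit[OF assms(1) _ that, of h g c] p by simp
      then show ?thesis
        by (simp only: cong_int_iff flip: of_nat_mult)
    qed
    have i: "i = p * (i div p) + i mod p" by simp
    have parity: "even i \<longleftrightarrow> (even (i div p) \<longleftrightarrow> even (i mod p))"
      using assms(2) i by (metis even_add even_mult_iff)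
    show ?thesis
    proof (cases "even (i div p)")
      case True
      then obtain c where c: "i div p = 2 * c" by (elim evenE)
      show ?thesis
      proof (cases "even (i mod p)")
        case True
        then obtain d where d: "i mod p = 2 * d" by (elim evenE)
        have "i div 2 = p * c + d" using i unfolding c d by simp
        then show ?thesis
          using cong_sym[OF lucas[of d c]] im parity c d by simp
      qed (use True parity in simp)
    next
      case False
      then obtain c where c: "i div p = 2 * c + 1" by (elim oddE)
      show ?thesis
      proof (cases "even (i mod p)")
        case False
        then obtain d where d: "i mod p = 2 * d + 1" by (elim oddE)
        \<comment> \<open>With quotient and remainder both odd, \<open>i\<close> is even but the
          last base-\<open>p\<close> digit of \<open>i div 2\<close> is \<open>h + d + 1\<close>. It
          exceeds \<open>h\<close>, so the binomial coefficient vanishes modulo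
          \<open>p\<close>.\<close>
        have "i = 2 * (p * c + (h + d + 1))" using i unfolding c d by (simp add: p algebra_simps)
        then have "i div 2 = p * c + (h + d + 1)" by simp
        then show ?thesis
          using cong_sym[OF lucas[of "h + d + 1" c]] im parity c d p by (simp add: binomial_eq_0)
      qed (use \<open>odd (i div p)\<close> parity in simp)
    qed
  qed
  finally show ?case by (simp only: G)
qed

section \<open>Valuations of the binomial determinants\<close>

text \<open>Legendre's formula. From \<open>n\<close> to \<open>Suc n\<close> the quotient by
  \<open>p ^ s\<close> grows exactly when \<open>p ^ s\<close> divides \<open>Suc n\<close>; the
  bound by \<open>p ^ R\<close> makes the terms with \<open>s \<ge> R\<close> vanish.\<close>

lemma multiplicity_fact:
  assumes "prime (p :: nat)" "n < p ^ R"
  shows "multiplicity p (fact n :: nat) = (\<Sum>s = 1..<R. n div p ^ s)"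
  using assms(2)
proof (induction n)
  case (Suc n)
  have "multiplicity p (fact (Suc n) :: nat) = multiplicity p (Suc n) + multiplicity p (fact n :: nat)"
    using assms(1) unfolding fact_Suc of_nat_id
    by (intro prime_elem_multiplicity_mult_distrib) auto
  also have "multiplicity p (Suc n) = card {s \<in> {1..<R}. p ^ s dvd Suc n}"
  proof -
    have "multiplicity p (Suc n) < R"
    proof (rule ccontr)
      assume "\<not> ?thesis"
      then have "p ^ R dvd Suc n" by (intro multiplicity_dvd') simp
      then show False using Suc.prems by (simp add: nat_dvd_not_less)
    qed
    moreover have "p ^ s dvd Suc n \<longleftrightarrow> s \<le> multiplicity p (Suc n)" for s
      using assms(1) by (intro power_dvd_iff_le_multiplicity) auto
    ultimately have "{s \<in> {1..<R}. p ^ s dvd Suc n} = {1..multiplicity p (Suc n)}"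
      unfolding set_eq_iff mem_Collect_eq atLeastAtMost_iff atLeastLessThan_iff
      by (meson le_less_trans)
    then show ?thesis by simp
  qed
  also have "\<dots> = (\<Sum>s = 1..<R. if p ^ s dvd Suc n then 1 else 0)"
    by (simp only: card_eq_sum sum.inter_filter[OF finite_atLeastLessThan])
  also have "multiplicity p (fact n :: nat) = (\<Sum>s = 1..<R. n div p ^ s)"
    using Suc by simp
  also have "(\<Sum>s = 1..<R. if p ^ s dvd Suc n then 1 else 0) + (\<Sum>s = 1..<R. n div p ^ s) =
      (\<Sum>s = 1..<R. Suc n div p ^ s)"
    unfolding sum.distrib[symmetric]
    by (intro sum.cong) (simp_all add: div_Suc mod_eq_0_iff_dvd)
  finally show ?case .
qed simp

text \<open>The contribution of \<open>q\<close> to the valuation of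
  \<open>(N + j)! j! / ((a + j)! (b + j)!)\<close>, the \<open>j\<close>-th factor of MacMahon's
  formula with \<open>N = a + b\<close>. A single term can be negative, hence the integer
  type.\<close>

definition floor_excess :: "nat \<Rightarrow> nat \<Rightarrow> nat \<Rightarrow> nat \<Rightarrow> int" where
  "floor_excess q a b j =
     int ((a + b + j) div q) + int (j div q) - int ((b + j) div q) - int ((a + j) div q)"

text \<open>Legendre's formula is applied to both sides of \<open>binom_det_fact\<close>. The bound
  \<open>N + k \<le> p ^ R\<close> keeps every factorial argument below \<open>p ^ R\<close>, so one
  range of \<open>s\<close> serves them all.\<close>

lemma multiplicity_binom_det:
  assumes "prime p" "N + k \<le> p ^ R" "a \<le> N"
  shows "binom_det N k a \<noteq> 0"
    and "int (multiplicity p (nat \<bar>binom_det N k a\<bar>)) =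
     (\<Sum>s = 1..<R. \<Sum>j<k. floor_excess (p ^ s) a (N - a) j)"
proof -
  let ?D = "binom_det N k a"
  note eq = binom_det_fact[OF assms(3), of k]
  have pos: "(\<Prod>j<k. fact (N + j) * fact j :: int) > 0" by (intro prod_pos) auto
  then show nz: "?D \<noteq> 0" using eq by auto
  have "?D > 0"
  proof (rule zero_less_mult_pos)
    show "0 < (\<Prod>i<k. fact (a + i) * fact (N - a + i)) * ?D" using pos eq by simp
  qed (intro prod_pos, auto)
  then obtain d where d: "?D = int d" "d > 0" using zero_less_imp_eq_int by auto
  have "int ((\<Prod>i<k. fact (a + i) * fact (N - a + i)) * d) = int (\<Prod>j<k. fact (N + j) * fact j)"
    using eq d by simp
  then have eq': "(\<Prod>i<k. fact (a + i) * fact (N - a + i)) * d = (\<Prod>j<k. fact (N + j) * fact j)"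
    by (simp only: of_nat_eq_iff)
  have fact_nz: "(fact n :: nat) \<noteq> 0" for n by simp
  have m: "multiplicity p (\<Prod>i<k. fact (f i) * fact (g i) :: nat) =
      (\<Sum>i<k. multiplicity p (fact (f i) :: nat) + multiplicity p (fact (g i) :: nat))" for f g
    using assms(1)
    by (subst prime_elem_multiplicity_prod_distrib) (auto simp: prime_elem_multiplicity_mult_distrib)
  have "(\<Sum>i<k. multiplicity p (fact (a + i) :: nat) + multiplicity p (fact (N - a + i) :: nat)) + multiplicity p d =
      (\<Sum>i<k. multiplicity p (fact (N + i) :: nat) + multiplicity p (fact i :: nat))"
    using arg_cong[OF eq', of "multiplicity p"] assms(1) d(2)
    by (subst (asm) prime_elem_multiplicity_mult_distrib) (auto simp: m)
  from arg_cong[OF this, of int] have "int (multiplicity p d) =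
      (\<Sum>i<k. int (multiplicity p (fact (N + i) :: nat)) + int (multiplicity p (fact i :: nat))
        - int (multiplicity p (fact (N - a + i) :: nat)) - int (multiplicity p (fact (a + i) :: nat)))"
    by (simp add: sum_subtractf sum.distrib)
  also have "\<dots> = (\<Sum>i<k. \<Sum>s = 1..<R. floor_excess (p ^ s) a (N - a) i)"
  proof (rule sum.cong)
    fix i assume "i \<in> {..<k}"
    then have "N + i < p ^ R" "i < p ^ R" "N - a + i < p ^ R" "a + i < p ^ R" using assms by auto
    then show "int (multiplicity p (fact (N + i) :: nat)) + int (multiplicity p (fact i :: nat))
        - int (multiplicity p (fact (N - a + i) :: nat)) - int (multiplicity p (fact (a + i) :: nat)) =
        (\<Sum>s = 1..<R. floor_excess (p ^ s) a (N - a) i)"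
      using assms(3)
      by (simp add: multiplicity_fact[OF assms(1), of _ R] floor_excess_def sum_subtractf sum.distrib)
  qed simp
  also have "\<dots> = (\<Sum>s = 1..<R. \<Sum>j<k. floor_excess (p ^ s) a (N - a) j)"
    by (rule sum.swap)
  finally show "int (multiplicity p (nat \<bar>?D\<bar>)) = \<dots>" by (simp add: d)
qed

text \<open>Since \<open>c + j < 2 * q\<close>, the quotient is 0 for \<open>j < q - c\<close> and 1
  afterwards; truncated subtraction covers \<open>k \<le> q - c\<close>.\<close>

lemma sum_div_short:
  assumes "c < q" "k \<le> (q :: nat)"
  shows "(\<Sum>j<k. (c + j) div q) = k - (q - c)"
  using assms(2)
proof (induction k)
  case (Suc k)
  then have "(c + k) div q = (if q \<le> c + k then 1 else 0)"
    using assms(1) by (auto simp: div_if)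
  with Suc assms show ?case by auto
qed simp

lemma sum_periodic:
  fixes f :: "nat \<Rightarrow> int"
  assumes "\<And>j. f (j + q) = f j" "(\<Sum>j<q. f j) = 0"
  shows "(\<Sum>j<k. f j) = (\<Sum>j<k mod q. f j)"
proof -
  have shift: "(\<Sum>j<q + n. f j) = (\<Sum>j<n. f j)" for n
    by (induction n) (use assms in \<open>auto simp: add.commute\<close>)
  have "(\<Sum>j<q * m + t. f j) = (\<Sum>j<t. f j)" for m t
    by (induction m) (use shift in \<open>auto simp: add.assoc\<close>)
  from this[of "k div q" "k mod q"] show ?thesis by simp
qed

text \<open>For \<open>q = 2h + 1\<close> these are the residues of \<open>(k, a)\<close> modulo \<open>q\<close> at which the sum of the excesses over
  \<open>j < k\<close> vanishes; see \<open>sum_floor_excess\<close>.\<close>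

definition unit_zone :: "nat \<Rightarrow> nat \<Rightarrow> nat \<Rightarrow> bool" where
  "unit_zone h k a \<longleftrightarrow>
     (if a \<le> h then k \<le> h + 1 \<or> a = 0 \<or> a = h else k = 0 \<or> h + 1 \<le> k)"

text \<open>The two cases for \<open>a + b\<close> are told apart by \<open>a \<le> h\<close>,
  because \<open>a + b = q + h\<close> and \<open>b < q\<close> force \<open>a > h\<close>. In that
  case the carry adds 1 to the quotient for every \<open>j\<close>, whence the summand
  \<open>k\<close>.\<close>

lemma short_excess_sign:
  fixes a b k q h :: nat
  assumes "q = 2 * h + 1" "a < q" "b < q" "k < q" "a + b = h \<or> a + b = q + h"
  shows "(if a \<le> h then 0 else int k) + int (k - (q - h)) - int (k - (q - b)) - int (k - (q - a)) \<ge> 0"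
    and "(if a \<le> h then 0 else int k) + int (k - (q - h)) - int (k - (q - b)) - int (k - (q - a)) = 0 \<longleftrightarrow>
      (if a \<le> h then k \<le> h + 1 \<or> a = 0 \<or> a = h else k = 0 \<or> h + 1 \<le> k)"
proof -
  \<comment> \<open>Writing truncated differences as maxima leaves a piecewise linear
    problem.\<close>
  have d: "int (x - (q - y)) = max 0 (int x + int y - int q)" if "y < q" for x y
    using that by auto
  have h: "h < q" using assms(1) by simp
  show "(if a \<le> h then 0 else int k) + int (k - (q - h)) - int (k - (q - b)) - int (k - (q - a)) \<ge> 0"
    unfolding d[OF assms(2)] d[OF assms(3)] d[OF h] using assms by (auto simp: max_def)
  show "(if a \<le> h then 0 else int k) + int (k - (q - h)) - int (k - (q - b)) - int (k - (q - a)) = 0 \<longleftrightarrow>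
      (if a \<le> h then k \<le> h + 1 \<or> a = 0 \<or> a = h else k = 0 \<or> h + 1 \<le> k)"
    unfolding d[OF assms(2)] d[OF assms(3)] d[OF h] using assms by (auto simp: max_def)
qed

text \<open>The quotients of \<open>a\<close> and \<open>b\<close> by \<open>q\<close> cancel, so
  both may be reduced modulo \<open>q\<close>. The excess is periodic in \<open>j\<close> with sum 0
  over a period, so \<open>k\<close> may be reduced as well, and \<open>short_excess_sign\<close>
  applies.\<close>

lemma sum_floor_excess:
  assumes q: "q = 2 * h + 1" and ab: "(a + b) mod q = h"
  shows "(\<Sum>j<k. floor_excess q a b j) \<ge> 0"
    and "(\<Sum>j<k. floor_excess q a b j) = 0 \<longleftrightarrow> unit_zone h (k mod q) (a mod q)"
proof -
  define a0 b0 where "a0 = a mod q" and "b0 = b mod q"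
  have "q > 0" using q by simp
  then have lt: "a0 < q" "b0 < q" by (auto simp: a0_def b0_def)
  have red: "floor_excess q a b j = floor_excess q a0 b0 j" for j
  proof -
    have a: "a = q * (a div q) + a0" and b: "b = q * (b div q) + b0"
      by (simp_all add: a0_def b0_def)
    have "(q * u + v) div q = u + v div q" for u v using \<open>q > 0\<close> by simp
    then have "(q * u + q * w + v) div q = u + w + v div q" for u v w
      by (metis add_mult_distrib2)
    note n = this[of "a div q" "b div q" "a0 + b0 + j"] this[of "a div q" 0 "a0 + j"]
      this[of 0 "b div q" "b0 + j"]
    have "a + b + j = q * (a div q) + q * (b div q) + (a0 + b0 + j)"
      "a + j = q * (a div q) + q * 0 + (a0 + j)" "b + j = q * 0 + q * (b div q) + (b0 + j)"
      using a b by linarith+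
    then have "(a + b + j) div q = a div q + b div q + (a0 + b0 + j) div q"
      "(a + j) div q = a div q + 0 + (a0 + j) div q" "(b + j) div q = 0 + b div q + (b0 + j) div q"
      by (simp_all only: n)
    then show ?thesis by (simp add: floor_excess_def)
  qed
  have per: "floor_excess q a0 b0 (j + q) = floor_excess q a0 b0 j" for j
    using \<open>q > 0\<close> by (simp add: floor_excess_def add.assoc[symmetric])
  have "(a0 + b0) mod q = h" using ab by (simp add: a0_def b0_def mod_add_eq)
  moreover have "(a0 + b0) mod q = (if a0 + b0 < q then a0 + b0 else a0 + b0 - q)"
    using lt by (auto simp: mod_if)
  ultimately have ab0: "a0 + b0 = h \<or> a0 + b0 = q + h" by (auto split: if_splits)
  then have short: "(\<Sum>j<k. floor_excess q a0 b0 j) =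
      (if a0 \<le> h then 0 else int k) + int (k - (q - h)) - int (k - (q - b0)) - int (k - (q - a0))"
    if "k \<le> q" for k
  proof
    assume "a0 + b0 = h"
    then show ?thesis
      using sum_div_short[OF lt(1) that] sum_div_short[OF lt(2) that] sum_div_short[of h q k]
        sum_div_short[of 0 q k] that q
      by (auto simp: floor_excess_def sum_subtractf sum.distrib simp flip: of_nat_sum)
  next
    assume 2: "a0 + b0 = q + h"
    have "(q + h + j) div q = Suc ((h + j) div q)" for j
      using \<open>q > 0\<close> by (simp add: add.assoc)
    with 2 show ?thesis
      using sum_div_short[OF lt(1) that] sum_div_short[OF lt(2) that] sum_div_short[of h q k]
        sum_div_short[of 0 q k] that q lt
      by (auto simp: floor_excess_def sum_subtractf sum.distrib simp flip: of_nat_sum)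
  qed
  \<comment> \<open>For \<open>k = q\<close> the short sum is \<open>h - a0 - b0\<close>, plus
    \<open>q\<close> if there is a carry, hence 0.\<close>
  have zero: "(\<Sum>j<q. floor_excess q a0 b0 j) = 0"
    using short[of q] lt ab0 q by auto
  have km: "k mod q < q" using \<open>q > 0\<close> by simp
  have "(\<Sum>j<k. floor_excess q a b j) = (\<Sum>j<k mod q. floor_excess q a0 b0 j)"
    unfolding red by (rule sum_periodic[OF per zero])
  also have "\<dots> = (if a0 \<le> h then 0 else int (k mod q)) + int (k mod q - (q - h))
      - int (k mod q - (q - b0)) - int (k mod q - (q - a0))"
    by (rule short) (use km in simp)
  finally have E: "(\<Sum>j<k. floor_excess q a b j) = \<dots>" .
  show "(\<Sum>j<k. floor_excess q a b j) \<ge> 0"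
    unfolding E using km lt ab0 q by (intro short_excess_sign) auto
  show "(\<Sum>j<k. floor_excess q a b j) = 0 \<longleftrightarrow> unit_zone h (k mod q) (a mod q)"
    unfolding E a0_def[symmetric] unit_zone_def
    using km lt ab0 q by (intro short_excess_sign) auto
qed

section \<open>Nonzero entries of the wall\<close>

text \<open>Every base-\<open>p\<close> digit of \<open>(p ^ r - 1) div 2\<close> is
  \<open>(p - 1) div 2\<close>, so its last \<open>s\<close> digits form
  \<open>(p ^ s - 1) div 2\<close>.\<close>

lemma half_power_mod:
  assumes "odd (p :: nat)" "s \<le> r"
  shows "((p ^ r - 1) div 2) mod p ^ s = p ^ s div 2"
proof -
  obtain h where h: "p ^ s = 2 * h + 1" using assms by (metis even_power oddE)
  obtain u where u: "p ^ (r - s) = 2 * u + 1" using assms by (metis even_power oddE)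
  have "p ^ r = p ^ s * p ^ (r - s)" using assms(2) by (simp flip: power_add)
  also have "\<dots> = 2 * (u * (2 * h + 1) + h) + 1" unfolding h u by (simp add: algebra_simps)
  finally have "(p ^ r - 1) div 2 = u * (2 * h + 1) + h" by simp
  then show ?thesis unfolding h by (simp del: mult_Suc_right)
qed

text \<open>The valuation is a sum of nonnegative terms, so it vanishes iff each term does. The
  bound on \<open>k\<close> gives \<open>N + k \<le> 2 * N + 1 = p ^ r\<close>.\<close>

lemma binom_det_unit_iff:
  assumes "prime p" "odd p" "N = (p ^ r - 1) div 2" "k \<le> N + 1" "a \<le> N"
  shows "\<not> int p dvd binom_det N k a \<longleftrightarrow>
     (\<forall>s\<in>{1..<r}. unit_zone (p ^ s div 2) (k mod p ^ s) (a mod p ^ s))"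
proof -
  have "odd (p ^ r)" using assms(2) by simp
  then have Nk: "N + k \<le> p ^ r" using assms(3,4) by (elim oddE) simp
  let ?E = "\<lambda>s. \<Sum>j<k. floor_excess (p ^ s) a (N - a) j"
  note D = multiplicity_binom_det[OF assms(1) Nk assms(5)]
  have "p ^ s = 2 * (p ^ s div 2) + 1" for s
    using assms(2) by (metis even_power odd_two_times_div_two_succ)
  moreover have "(a + (N - a)) mod p ^ s = p ^ s div 2" if "s < r" for s
    using half_power_mod[OF assms(2), of s r] that assms(3,5) by simp
  ultimately have E: "?E s \<ge> 0" "?E s = 0 \<longleftrightarrow> unit_zone (p ^ s div 2) (k mod p ^ s) (a mod p ^ s)"
    if "s < r" for s
    using sum_floor_excess[of "p ^ s" "p ^ s div 2" a "N - a" k] that by auto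
  have "int p dvd binom_det N k a \<longleftrightarrow> p dvd nat \<bar>binom_det N k a\<bar>"
    by simp
  also have "\<dots> \<longleftrightarrow> multiplicity p (nat \<bar>binom_det N k a\<bar>) \<noteq> 0"
    using D(1) assms(1) by (subst multiplicity_eq_zero_iff) auto
  also have "\<dots> \<longleftrightarrow> (\<Sum>s = 1..<r. ?E s) \<noteq> 0"
    unfolding D(2)[symmetric] by simp
  also have "\<dots> \<longleftrightarrow> \<not> (\<forall>s\<in>{1..<r}. ?E s = 0)"
    using E(1) by (subst sum_nonneg_eq_0_iff) auto
  finally show ?thesis using E(2) by auto
qed

text \<open>The polynomial \<open>(1 + t^2)^N\<close> has degree \<open>2 * N = p ^ r - 1\<close>,
  so padding with zeros outside the first \<open>p ^ r\<close> terms agrees with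
  \<open>binom_int\<close>.\<close>

lemma cantor_trunc_cong:
  assumes "prime p" "odd p" "N = (p ^ r - 1) div 2"
  shows "[cantor_trunc p r z = (if even z then binom_int N (z div 2) else 0)] (mod int p)"
proof (cases "0 \<le> z \<and> z < int p ^ r")
  case True
  then obtain i where z: "z = int i" "i < p ^ r"
    by (metis nonneg_int_cases of_nat_less_iff of_nat_power)
  have "cantor_trunc p r z = cantor_word p r ! i"
    using cantor_seq_eq[OF assms(2) prime_gt_1_nat[OF assms(1)] z(2)] z True
    by (simp add: cantor_trunc_def)
  also have "(if even z then binom_int N (z div 2) else 0) =
      (if even i then int (((p ^ r - 1) div 2) choose (i div 2)) else 0)"
    using z assms(3) by (auto simp: binom_int_def nat_div_distrib)
  ultimately show ?thesis
    using cantor_word_cong[OF assms(1,2) z(2)] by simp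
next
  case False
  have "binom_int N (z div 2) = 0" if "even z"
  proof (cases "z < 0")
    case f: False
    have "odd (p ^ r)" using assms(2) by simp
    then have N: "p ^ r = 2 * N + 1" using assms(3) by (elim oddE) simp
    have "int (p ^ r) \<le> z" using False f by simp
    then have "N < nat (z div 2)" unfolding N using that by (elim evenE) simp
    then show ?thesis by (simp add: binom_int_def binomial_eq_0)
  qed (simp add: binom_int_def)
  moreover have "cantor_trunc p r z = 0"
    unfolding cantor_trunc_def using False by (rule if_not_P)
  ultimately show ?thesis by simp
qed

text \<open>Modulo \<open>p\<close> an entry vanishes when \<open>i - j + n\<close> is odd. Hence
  the parity of \<open>n\<close> selects the splitting for even or odd support, applied to a matrix
  of size \<open>m + 1\<close>.\<close>

lemma cantor_wall_unit_iff:
  assumes "prime p" "odd p" "N = (p ^ r - 1) div 2"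
  shows "even n \<Longrightarrow> cantor_wall p r m n \<noteq> 0 \<longleftrightarrow>
      \<not> int p dvd binom_det N (m div 2 + 1) (n div 2) \<and>
      \<not> int p dvd binom_det N ((m + 1) div 2) (n div 2)"
    and "odd n \<Longrightarrow> odd m \<Longrightarrow> cantor_wall p r m n \<noteq> 0 \<longleftrightarrow>
      \<not> int p dvd binom_det N ((m + 1) div 2) (n div 2) \<and>
      \<not> int p dvd binom_det N ((m + 1) div 2) (n div 2 + 1)"
    and "odd n \<Longrightarrow> even m \<Longrightarrow> cantor_wall p r m n = 0"
proof -
  define g where "g z = (if even z then binom_int N (z div 2) else 0)" for z
  let ?f = "\<lambda>z. g (z + int n)"
  have "cantor_wall p r m n = Determinant.det (toeplitz (m + 1) ?f) mod int p"
    using det_mat_cong_mod[of "m + 1" "\<lambda>(i, j). cantor_trunc p r (int i - int j + int n)"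
        "\<lambda>(i, j). ?f (int i - int j)" "int p"] cantor_trunc_cong[OF assms]
    by (simp add: cantor_wall_def g_def cong_def)
  then have wall: "cantor_wall p r m n \<noteq> 0 \<longleftrightarrow> \<not> int p dvd \<bar>Determinant.det (toeplitz (m + 1) ?f)\<bar>"
    by (simp only: mod_eq_0_iff_dvd dvd_abs_iff)
  have p: "prime (int p)" using assms(1) by simp
  have f_even: "?f (2 * z) = binom_int N (z + int (n div 2))" if "even n" for z
  proof -
    have "2 * z + int n = 2 * (z + int (n div 2))" using that by (elim evenE) simp
    then show ?thesis unfolding g_def by simp
  qed
  have f_odd: "?f (2 * z - 1) = binom_int N (z + int (n div 2))"
    "?f (2 * z + 1) = binom_int N (z + int (n div 2 + 1))" if "odd n" for z
    using that by (auto elim!: oddE simp: g_def algebra_simps)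
  show "cantor_wall p r m n \<noteq> 0 \<longleftrightarrow>
      \<not> int p dvd binom_det N (m div 2 + 1) (n div 2) \<and>
      \<not> int p dvd binom_det N ((m + 1) div 2) (n div 2)" if "even n"
  proof -
    have "\<bar>Determinant.det (toeplitz (m + 1) ?f)\<bar> =
        \<bar>binom_det N (m div 2 + 1) (n div 2) * binom_det N ((m + 1) div 2) (n div 2)\<bar>"
      using toeplitz_even_support[of ?f "m + 1"] f_even that by (simp add: g_def)
    then show ?thesis unfolding wall by (simp only: dvd_abs_iff prime_dvd_mult_iff[OF p] de_Morgan_disj)
  qed
  show "cantor_wall p r m n \<noteq> 0 \<longleftrightarrow>
      \<not> int p dvd binom_det N ((m + 1) div 2) (n div 2) \<and>
      \<not> int p dvd binom_det N ((m + 1) div 2) (n div 2 + 1)" if "odd n" "odd m"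
  proof -
    have "2 * ((m + 1) div 2) = m + 1" using \<open>odd m\<close> by simp
    moreover have "?f z = 0" if "even z" for z
      using that \<open>odd n\<close> by (simp add: g_def)
    ultimately have "\<bar>Determinant.det (toeplitz (m + 1) ?f)\<bar> =
        \<bar>binom_det N ((m + 1) div 2) (n div 2) * binom_det N ((m + 1) div 2) (n div 2 + 1)\<bar>"
      using toeplitz_odd_support[of ?f "(m + 1) div 2"] unfolding f_odd[OF \<open>odd n\<close>] by metis
    then show ?thesis unfolding wall by (simp only: dvd_abs_iff prime_dvd_mult_iff[OF p] de_Morgan_disj)
  qed
  show "cantor_wall p r m n = 0" if "odd n" "even m"
    using toeplitz_odd_support_odd_size[of ?f "m div 2"] that wall by (auto simp: g_def)
qed

section \<open>Unit zones and parities of quotients\<close>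

text \<open>Both sides are \<open>n mod (2 * q)\<close>, expanded with the factors 2 and
  \<open>q\<close> in either order. This ties the residue of \<open>n div 2\<close> to the parity of
  \<open>n div q\<close>.\<close>

lemma half_mod_eq:
  "2 * (n div 2 mod q) + n mod 2 = q * (n div q mod 2) + n mod q" for n q :: nat
  using mod_mult2_eq[of n 2 q] mod_mult2_eq[of n q 2] by (simp add: mult.commute)

text \<open>By \<open>half_mod_eq\<close>, equal parity of the quotients puts the residues
  \<open>K\<close> and \<open>A\<close> of \<open>m div 2\<close> and \<open>n div 2\<close> on the
  same side of \<open>q / 2\<close>.\<close>

lemma unit_zone_same_parity:
  assumes q: "q = 2 * h + 1" and h: "h \<ge> 1" and "even (m div q + n div q)"
  shows "even m \<Longrightarrow> even n \<Longrightarrow>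
      unit_zone h (m div 2 mod q) (n div 2 mod q) \<and> unit_zone h ((m div 2 + 1) mod q) (n div 2 mod q)"
    and "odd m \<Longrightarrow> odd n \<Longrightarrow>
      unit_zone h ((m div 2 + 1) mod q) (n div 2 mod q) \<and>
      unit_zone h ((m div 2 + 1) mod q) ((n div 2 + 1) mod q)"
proof -
  define K A where KA: "K = m div 2 mod q" "A = n div 2 mod q"
  have lt: "m mod q < q" "n mod q < q" "K < q" "A < q" using q KA by auto
  have "even (x + y) \<longleftrightarrow> x mod 2 = y mod 2" for x y :: nat by presburger
  with assms(3) have e: "m div q mod 2 = n div q mod 2" by blast
  note M = half_mod_eq[of m q, folded KA] and N = half_mod_eq[of n q, folded KA]
  have S: "(m div 2 + 1) mod q = (if K + 1 = q then 0 else K + 1)"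
    "(n div 2 + 1) mod q = (if A + 1 = q then 0 else A + 1)"
    using mod_Suc[of "m div 2" q] mod_Suc[of "n div 2" q] by (auto simp: KA)
  have bit: "n div q mod 2 = 0 \<or> n div q mod 2 = 1" by auto
  show "unit_zone h (m div 2 mod q) (n div 2 mod q) \<and> unit_zone h ((m div 2 + 1) mod q) (n div 2 mod q)"
    if "even m" "even n"
  proof -
    have z: "m mod 2 = 0" "n mod 2 = 0" using that by (simp_all only: even_iff_mod_2_eq_zero)
    have "2 * K = q * (n div q mod 2) + m mod q" "2 * A = q * (n div q mod 2) + n mod q"
      using M N by (simp_all only: z e add_0_right)
    then have "2 * K = m mod q \<and> 2 * A = n mod q \<or> 2 * K = q + m mod q \<and> 2 * A = q + n mod q"
      using bit by auto
    then have "K \<le> h \<and> A \<le> h \<or> h < K \<and> h < A" using lt(1,2) q by linarith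
    then show ?thesis unfolding S KA[symmetric] unit_zone_def using lt(3,4) q h by auto
  qed
  show "unit_zone h ((m div 2 + 1) mod q) (n div 2 mod q) \<and>
      unit_zone h ((m div 2 + 1) mod q) ((n div 2 + 1) mod q)" if "odd m" "odd n"
  proof -
    have z: "m mod 2 = 1" "n mod 2 = 1" using that by (simp_all only: odd_iff_mod_2_eq_one)
    have "2 * K + 1 = q * (n div q mod 2) + m mod q" "2 * A + 1 = q * (n div q mod 2) + n mod q"
      using M N by (simp_all only: z e)
    then have "2 * K + 1 = m mod q \<and> 2 * A + 1 = n mod q \<or>
        2 * K + 1 = q + m mod q \<and> 2 * A + 1 = q + n mod q"
      using bit by auto
    \<comment> \<open>In the upper case \<open>h\<close> itself is possible: \<open>A = h\<close>
      and \<open>A + 1 = q\<close>, which wraps to 0, are the two exceptional values of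
      \<open>a\<close> in \<open>unit_zone\<close>.\<close>
    then have "K < h \<and> A < h \<or> h \<le> K \<and> h \<le> A" using lt(1,2) q by linarith
    then show ?thesis unfolding S KA[symmetric] unit_zone_def using lt(3,4) q h by auto
  qed
qed

text \<open>Off the edges, unequal parities put \<open>K\<close> and \<open>A\<close> strictly on
  opposite sides, where one of the required zones fails.\<close>

lemma unit_zone_imp_same_parity:
  assumes q: "q = 2 * h + 1" and h: "h \<ge> 2"
    and "\<not> (m mod q \<in> {0, q - 1} \<or> n mod q \<in> {0, q - 1})"
    and "even n \<and> unit_zone h ((m div 2 + 1) mod q) (n div 2 mod q) \<and>
          unit_zone h ((m + 1) div 2 mod q) (n div 2 mod q) \<or>
        odd n \<and> odd m \<and> unit_zone h ((m + 1) div 2 mod q) (n div 2 mod q) \<and>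
          unit_zone h ((m + 1) div 2 mod q) ((n div 2 + 1) mod q)"
  shows "even (m div q + n div q)"
proof -
  define K A where KA: "K = m div 2 mod q" "A = n div 2 mod q"
  have lt: "m mod q < q" "n mod q < q" "K < q" "A < q" using q KA by auto
  note M = half_mod_eq[of m q, folded KA] and N = half_mod_eq[of n q, folded KA]
  have S: "(m div 2 + 1) mod q = (if K + 1 = q then 0 else K + 1)"
    "(n div 2 + 1) mod q = (if A + 1 = q then 0 else A + 1)"
    using mod_Suc[of "m div 2" q] mod_Suc[of "n div 2" q] by (auto simp: KA)
  have half: "(m + 1) div 2 mod q = (if odd m then (m div 2 + 1) mod q else m div 2 mod q)" by simp
  have bits: "n div q mod 2 = 0 \<or> n div q mod 2 = 1" "m div q mod 2 = 0 \<or> m div q mod 2 = 1" by auto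
  have ne: "m mod q \<noteq> 0" "m mod q \<noteq> q - 1" "n mod q \<noteq> 0" "n mod q \<noteq> q - 1"
    using assms(3) by auto
  have pos: "0 < m mod q" "m mod q < 2 * h" "0 < n mod q" "n mod q < 2 * h"
    using lt(1,2) q ne by linarith+
  have bit: "(if even x then c else c + 1) = c + x mod 2" for c x :: nat
    by (simp add: mod2_eq_if)
  have parity: "(if even m then 2 * K else 2 * K + 1) = m div q mod 2 * q + m mod q"
    "(if even n then 2 * A else 2 * A + 1) = n div q mod 2 * q + n mod q"
    using M N by (simp_all only: bit mult.commute[of q])
  have "m div q mod 2 = n div q mod 2"
  proof (rule ccontr)
    assume "m div q mod 2 \<noteq> n div q mod 2"
    with bits consider "m div q mod 2 = 0" "n div q mod 2 = 1" | "m div q mod 2 = 1" "n div q mod 2 = 0"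
      by auto
    then show False
    proof cases
      \<comment> \<open>Here \<open>1 \<le> K + 1 \<le> h < A\<close>, outside the zone.\<close>
      case 1
      then have "(if even m then 2 * K else 2 * K + 1) = m mod q"
        "(if even n then 2 * A else 2 * A + 1) = q + n mod q"
        using parity by simp_all
      then have "K < h" "0 < K \<or> odd m" "h < A" using pos q by (auto split: if_splits)
      moreover have "K + 1 \<noteq> q" using \<open>K < h\<close> q by simp
      ultimately show False
        using assms(4) unfolding half S KA[symmetric] unit_zone_def by (auto split: if_splits)
    next
      \<comment> \<open>For even \<open>n\<close>, \<open>K + 1 \<ge> h + 2\<close> fails the zone,
        and if \<open>K + 1\<close> wraps to 0, then \<open>m\<close> is even and
        \<open>K = 2 * h\<close> itself fails. For odd \<open>n\<close>, one of \<open>A\<close> and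
        \<open>A + 1\<close> lies strictly between 0 and \<open>h\<close>. Both use
        \<open>h \<ge> 2\<close>.\<close>
      case 2
      then have m: "(if even m then 2 * K else 2 * K + 1) = q + m mod q"
        and n: "(if even n then 2 * A else 2 * A + 1) = n mod q"
        using parity by simp_all
      have A: "A < h" "0 < A \<or> odd n" using n pos q by (auto split: if_splits)
      have K: "h + 1 \<le> K" "even m \<or> K + 1 \<noteq> q" using m pos q by (auto split: if_splits)
      have "A + 1 \<noteq> q" using A q by auto
      then show False
        using assms(4) A K q h unfolding half S KA[symmetric] unit_zone_def by (auto split: if_splits)
    qed
  qed
  moreover have "even (x + y) \<longleftrightarrow> x mod 2 = y mod 2" for x y :: nat by presburger
  ultimately show ?thesis by blast
qed

text \<open>Position \<open>s = 0\<close> gives \<open>m\<close> and \<open>n\<close> the same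
  parity, which rules out the vanishing case; the positions \<open>s \<ge> 1\<close> supply the unit
  zones of both factors.\<close>

lemma cantor_wall_nonzero:
  assumes "prime p" "odd p" "m < p ^ r" "n < p ^ r"
    and "\<And>s. s < r \<Longrightarrow> even (m div p ^ s + n div p ^ s)"
  shows "cantor_wall p r m n \<noteq> 0"
proof -
  define N where "N = (p ^ r - 1) div 2"
  have "odd (p ^ r)" using assms(2) by simp
  then have pr: "p ^ r = 2 * N + 1" by (auto simp: N_def elim: oddE)
  have par: "even m \<longleftrightarrow> even n"
    using assms(3,4) assms(5)[of 0] by (cases "r = 0") auto
  have zone: "p ^ s = 2 * (p ^ s div 2) + 1" "p ^ s div 2 \<ge> 1" "even (m div p ^ s + n div p ^ s)"
    if "s \<in> {1..<r}" for s
  proof -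
    have "odd (p ^ s)" using assms(2) by simp
    then obtain h where h: "p ^ s = 2 * h + 1" by (elim oddE)
    have "p ^ s \<noteq> 1" using that prime_gt_1_nat[OF assms(1)] by simp
    with h show "p ^ s = 2 * (p ^ s div 2) + 1" "p ^ s div 2 \<ge> 1" by simp_all
    show "even (m div p ^ s + n div p ^ s)" using assms(5) that by simp
  qed
  note unit = binom_det_unit_iff[OF assms(1,2) N_def]
  show ?thesis
  proof (cases "even n")
    case True
    with par have "even m" by simp
    have b: "m div 2 + 1 \<le> N + 1" "m div 2 \<le> N + 1" "n div 2 \<le> N" using assms(3,4) pr by auto
    have "(m + 1) div 2 = m div 2" using \<open>even m\<close> by simp
    then show ?thesis
      unfolding cantor_wall_unit_iff(1)[OF assms(1,2) N_def True]
      using unit_zone_same_parity(1)[OF zone \<open>even m\<close> True]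
      by (simp only: unit[OF b(1,3)] unit[OF b(2,3)]) blast
  next
    case False
    with par have "odd m" by simp
    have b: "m div 2 + 1 \<le> N + 1" "n div 2 + 1 \<le> N" "n div 2 \<le> N"
      using assms(3,4) pr False \<open>odd m\<close> by (auto elim!: oddE)
    have "(m + 1) div 2 = m div 2 + 1" using \<open>odd m\<close> by simp
    then show ?thesis
      unfolding cantor_wall_unit_iff(2)[OF assms(1,2) N_def False \<open>odd m\<close>]
      using unit_zone_same_parity(2)[OF zone \<open>odd m\<close> False]
      by (simp only: unit[OF b(1,3)] unit[OF b(1,2)]) blast
  qed
qed

text \<open>A converse off the edges of the squares of side \<open>p ^ s\<close>. Requiring
  \<open>s \<ge> 2\<close> ensures \<open>p ^ s div 2 \<ge> 2\<close> even for
  \<open>p = 3\<close>.\<close>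

lemma cantor_wall_nonzero_imp:
  assumes "prime p" "odd p" "m < p ^ r" "n < p ^ r" "cantor_wall p r m n \<noteq> 0" "2 \<le> s" "s < r"
  shows "even (m div p ^ s + n div p ^ s) \<or> m mod p ^ s \<in> {0, p ^ s - 1} \<or> n mod p ^ s \<in> {0, p ^ s - 1}"
proof -
  define N where "N = (p ^ r - 1) div 2"
  have "odd (p ^ r)" using assms(2) by simp
  then have pr: "p ^ r = 2 * N + 1" by (auto simp: N_def elim: oddE)
  have s: "s \<in> {1..<r}" using assms by auto
  have q: "p ^ s = 2 * (p ^ s div 2) + 1"
    using assms(2) by (metis even_power odd_two_times_div_two_succ)
  have "p \<ge> 3" using prime_ge_2_nat[OF assms(1)] assms(2) by (cases "p = 2") auto
  then have "3 ^ 2 \<le> p ^ s"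
    using assms(6) by (meson le_trans power_increasing power_mono numeral_le_iff one_le_numeral zero_le_numeral)
  then have h: "p ^ s div 2 \<ge> 2" by simp
  note unit = binom_det_unit_iff[OF assms(1,2) N_def]
  have "even n \<and> unit_zone (p ^ s div 2) ((m div 2 + 1) mod p ^ s) (n div 2 mod p ^ s) \<and>
          unit_zone (p ^ s div 2) ((m + 1) div 2 mod p ^ s) (n div 2 mod p ^ s) \<or>
        odd n \<and> odd m \<and> unit_zone (p ^ s div 2) ((m + 1) div 2 mod p ^ s) (n div 2 mod p ^ s) \<and>
          unit_zone (p ^ s div 2) ((m + 1) div 2 mod p ^ s) ((n div 2 + 1) mod p ^ s)"
  proof (cases "even n")
    case True
    have b: "m div 2 + 1 \<le> N + 1" "(m + 1) div 2 \<le> N + 1" "n div 2 \<le> N" using assms(3,4) pr by auto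
    show ?thesis
      using assms(5) s True
      unfolding cantor_wall_unit_iff(1)[OF assms(1,2) N_def True] unit[OF b(1,3)] unit[OF b(2,3)]
      by blast
  next
    case False
    have "odd m" using cantor_wall_unit_iff(3)[OF assms(1,2) N_def False] assms(5) by blast
    have b: "(m + 1) div 2 \<le> N + 1" "n div 2 + 1 \<le> N" "n div 2 \<le> N"
      using assms(3,4) pr False \<open>odd m\<close> by (auto elim!: oddE)
    show ?thesis
      using assms(5) s False \<open>odd m\<close>
      unfolding cantor_wall_unit_iff(2)[OF assms(1,2) N_def False \<open>odd m\<close>]
        unit[OF b(1,3)] unit[OF b(1,2)] by blast
  qed
  with unit_zone_imp_same_parity[OF q h] show ?thesis by blast
qed

section \<open>Sets of Hausdorff measure zero\<close>

lemma hausdorff_nullD: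
  fixes A :: "'a::metric_space set"
  assumes "hausdorff_measure s A = 0" "e > 0"
  obtains U :: "nat \<Rightarrow> 'a set" where "A \<subseteq> (\<Union>i. U i)" "\<And>i. bounded (U i)" "\<And>i. diameter (U i) \<le> 1"
    "(\<Sum>i. hausdorff_gauge s (U i)) < ennreal e"
proof -
  have "hausdorff_premeasure s 1 A \<le> hausdorff_measure s A"
    unfolding hausdorff_measure_def by (rule SUP_upper) simp
  with assms have "hausdorff_premeasure s 1 A < ennreal e" by simp
  then show ?thesis
    unfolding hausdorff_premeasure_def INF_less_iff using that by blast
qed

lemma hausdorff_nullI:
  fixes A :: "'a::metric_space set"
  assumes "s > 0"
    and "\<And>e. e > 0 \<Longrightarrow> \<exists>U. A \<subseteq> (\<Union>i. U i) \<and> (\<forall>i. bounded (U i)) \<and>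
      (\<Sum>i. hausdorff_gauge s (U i)) \<le> ennreal e"
  shows "hausdorff_measure s A = 0"
proof -
  have small: "hausdorff_premeasure s \<delta> A \<le> 0 + ennreal e" if "\<delta> > 0" "e > 0" for \<delta> e
  proof -
    have "min e (\<delta> powr s) > 0" using that by simp
    from assms(2)[OF this] obtain U where U: "A \<subseteq> (\<Union>i. U i)" "\<And>i. bounded (U i)"
      "(\<Sum>i. hausdorff_gauge s (U i)) \<le> ennreal (min e (\<delta> powr s))" by blast
    have dU: "diameter (U i) \<le> \<delta>" for i
    proof (cases "U i = {}")
      case False
      have "hausdorff_gauge s (U i) \<le> (\<Sum>i. hausdorff_gauge s (U i))"
        using sum_le_suminf[OF summableI, of "{i}" "\<lambda>i. hausdorff_gauge s (U i)"] by simp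
      also note U(3)
      finally have "ennreal (diameter (U i) powr s) \<le> ennreal (min e (\<delta> powr s))"
        using False assms(1) by (simp add: hausdorff_gauge_def)
      then have "diameter (U i) powr s \<le> min e (\<delta> powr s)"
        using that by (subst (asm) ennreal_le_iff) auto
      then have "diameter (U i) powr s \<le> \<delta> powr s" by simp
      then show ?thesis
        using powr_less_mono2[of s \<delta> "diameter (U i)"] assms(1) that by linarith
    qed (use that in simp)
    have "U \<in> {U. A \<subseteq> (\<Union>i. U i) \<and> (\<forall>i. bounded (U i) \<and> diameter (U i) \<le> \<delta>)}"
      by (intro CollectI conjI allI U(1,2) dU)
    then have "hausdorff_premeasure s \<delta> A \<le> (\<Sum>i. hausdorff_gauge s (U i))"
      unfolding hausdorff_premeasure_def by (rule INF_lower)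
    also have "\<dots> \<le> ennreal e" using U(3) by (rule order_trans) (simp add: ennreal_leI)
    finally show ?thesis by simp
  qed
  have "hausdorff_premeasure s \<delta> A \<le> 0" if "\<delta> > 0" for \<delta>
    by (rule ennreal_le_epsilon) (rule small[OF that])
  then have "(SUP \<delta>\<in>{0<..}. hausdorff_premeasure s \<delta> A) \<le> 0"
    by (intro SUP_least) auto
  then show ?thesis by (simp add: hausdorff_measure_def)
qed

lemma hausdorff_null_subset:
  assumes "hausdorff_measure s B = 0" "A \<subseteq> B"
  shows "hausdorff_measure s A = 0"
proof -
  have "hausdorff_premeasure s \<delta> A \<le> hausdorff_premeasure s \<delta> B" for \<delta>
    unfolding hausdorff_premeasure_def using assms(2) by (intro INF_superset_mono) auto
  then have "hausdorff_measure s A \<le> hausdorff_measure s B"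
    unfolding hausdorff_measure_def by (intro SUP_mono) auto
  with assms(1) show ?thesis by simp
qed

text \<open>On sets of diameter at most 1 the gauge decreases as the exponent grows.\<close>

lemma hausdorff_null_exponent_mono:
  assumes "hausdorff_measure s A = 0" "0 \<le> s" "s \<le> t" "0 < t"
  shows "hausdorff_measure t A = 0"
proof (rule hausdorff_nullI)
  fix e :: real assume "e > 0"
  then obtain U where U: "A \<subseteq> (\<Union>i. U i)" "\<And>i. bounded (U i)" "\<And>i. diameter (U i) \<le> 1"
    "(\<Sum>i. hausdorff_gauge s (U i)) < ennreal e"
    using hausdorff_nullD[OF assms(1)] by metis
  have "hausdorff_gauge t (U i) \<le> hausdorff_gauge s (U i)" for i
  proof -
    have d: "0 \<le> diameter (U i)" "diameter (U i) \<le> 1" using U diameter_ge_0 by auto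
    \<comment> \<open>This serves \<open>s = 0\<close>, where a nonempty set has gauge 1.\<close>
    have "diameter (U i) powr t \<le> 1" using powr_le1[of t] d assms by simp
    moreover have "diameter (U i) powr t \<le> diameter (U i) powr s"
      using d assms by (intro powr_mono') auto
    ultimately show ?thesis using assms by (auto simp: hausdorff_gauge_def intro!: ennreal_leI)
  qed
  then have "(\<Sum>i. hausdorff_gauge t (U i)) \<le> (\<Sum>i. hausdorff_gauge s (U i))"
    by (intro suminf_le summableI) auto
  also have "\<dots> \<le> ennreal e" using U(4) by simp
  finally show "\<exists>U. A \<subseteq> (\<Union>i. U i) \<and> (\<forall>i. bounded (U i)) \<and> (\<Sum>i. hausdorff_gauge t (U i)) \<le> ennreal e"
    using U by blast
qed fact

text \<open>The \<open>n\<close>-th set receives a cover of total gauge at most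
  \<open>e / 2 ^ (n + 1)\<close>; \<open>prod_decode\<close> flattens the double sequence.\<close>

lemma hausdorff_null_UN:
  fixes A :: "'i \<Rightarrow> 'a::metric_space set"
  assumes "s > 0" "countable I" "\<And>i. i \<in> I \<Longrightarrow> hausdorff_measure s (A i) = 0"
  shows "hausdorff_measure s (\<Union>i\<in>I. A i) = 0"
proof (cases "I = {}")
  case True
  have "hausdorff_measure s ({} :: 'a set) = 0"
    by (rule hausdorff_nullI[OF assms(1)]) (auto intro!: exI[of _ "\<lambda>_. {}"] simp: hausdorff_gauge_def)
  with True show ?thesis by simp
next
  case False
  define B where "B n = A (from_nat_into I n)" for n
  have B: "hausdorff_measure s (B n) = 0" for n
    using assms(3) from_nat_into[OF False] by (simp add: B_def)
  have "(\<Union>i\<in>I. A i) = (\<Union>n. A (from_nat_into I n))"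
    using range_from_nat_into[OF False assms(2)] by (metis image_image)
  then have UN: "(\<Union>i\<in>I. A i) = (\<Union>n. B n)" by (simp add: B_def)
  show ?thesis
  proof (rule hausdorff_nullI)
    fix e :: real assume e: "e > 0"
    have "\<exists>U. B n \<subseteq> (\<Union>i. U i) \<and> (\<forall>i. bounded (U i)) \<and>
        (\<Sum>i. hausdorff_gauge s (U i)) \<le> ennreal (e * (1/2) ^ Suc n)" for n
    proof -
      have "e * (1/2) ^ Suc n > 0" using e by simp
      then obtain U where "B n \<subseteq> (\<Union>i. U i)" "\<And>i. bounded (U i)"
        "(\<Sum>i. hausdorff_gauge s (U i)) < ennreal (e * (1/2) ^ Suc n)"
        by (rule hausdorff_nullD[OF B]) blast
      then show ?thesis by (intro exI[of _ U] conjI allI less_imp_le[of "suminf _"])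
    qed
    then obtain U where U: "\<And>n. B n \<subseteq> (\<Union>i. U n i)" "\<And>n i. bounded (U n i)"
      "\<And>n. (\<Sum>i. hausdorff_gauge s (U n i)) \<le> ennreal (e * (1/2) ^ Suc n)" by metis
    define V where "V k = case_prod U (prod_decode k)" for k
    have "(\<Union>n. B n) \<subseteq> (\<Union>k. V k)"
    proof clarify
      fix x n assume "x \<in> B n"
      then obtain i where "x \<in> U n i" using U(1) by blast
      then have "x \<in> V (prod_encode (n, i))" by (simp add: V_def)
      then show "x \<in> (\<Union>k. V k)" by blast
    qed
    moreover have "bounded (V k)" for k
      using U(2) by (simp add: V_def split: prod.split)
    moreover have "(\<Sum>k. hausdorff_gauge s (V k)) \<le> ennreal e"
    proof -
      have "(\<Sum>k. hausdorff_gauge s (V k)) = (\<Sum>k. (\<lambda>(n, i). hausdorff_gauge s (U n i)) (prod_decode k))"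
        by (intro arg_cong[of _ _ suminf]) (auto simp: V_def split: prod.split)
      also have "\<dots> = (\<Sum>n. \<Sum>i. hausdorff_gauge s (U n i))"
        by (rule suminf_ennreal_2dimen) simp
      also have "\<dots> \<le> (\<Sum>n. ennreal (e * (1/2) ^ Suc n))"
        using U(3) by (intro suminf_le summableI) auto
      also have "\<dots> = ennreal (e * 1)"
        using e by (intro suminf_ennreal_eq sums_mult power_half_series) auto
      finally show ?thesis by simp
    qed
    ultimately show "\<exists>V. (\<Union>i\<in>I. A i) \<subseteq> (\<Union>i. V i) \<and> (\<forall>i. bounded (V i)) \<and>
        (\<Sum>i. hausdorff_gauge s (V i)) \<le> ennreal e"
      unfolding UN by blast
  qed fact
qed

lemma hausdorff_null_Un:
  assumes "s > 0" "hausdorff_measure s A = 0" "hausdorff_measure s B = 0"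
  shows "hausdorff_measure s (A \<union> B) = 0"
proof -
  have "hausdorff_measure s (\<Union>b\<in>{True, False}. if b then A else B) = 0"
    using assms by (intro hausdorff_null_UN) auto
  then show ?thesis by (simp add: Un_commute)
qed

text \<open>The cover of level \<open>n\<close> has total gauge at most
  \<open>C powr s * (N / b powr s) ^ n\<close>, which tends to 0.\<close>

lemma hausdorff_null_geometric:
  fixes A :: "'a::metric_space set" and b C :: real and N :: nat
  assumes "s > 0" "b > 0" "C > 0" "real N < b powr s"
    and cover: "\<And>n. A \<subseteq> (\<Union>i<N ^ n. c n i)"
    and size: "\<And>n i. i < N ^ n \<Longrightarrow> bounded (c n i) \<and> diameter (c n i) \<le> C / b ^ n"
  shows "hausdorff_measure s A = 0"
proof (rule hausdorff_nullI)
  fix e :: real assume e: "e > 0"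
  have eq: "real (N ^ n) * (C / b ^ n) powr s = C powr s * (real N / b powr s) ^ n" for n
    using assms(2,3) by (simp add: powr_divide powr_realpow[symmetric] powr_powr power_divide mult.commute)
  have "(\<lambda>n. C powr s * (real N / b powr s) ^ n) \<longlonglongrightarrow> C powr s * 0"
    using assms(2,4) by (intro tendsto_mult tendsto_const LIMSEQ_realpow_zero) auto
  then have "\<forall>\<^sub>F n in sequentially. C powr s * (real N / b powr s) ^ n < e"
    using e by (intro order_tendstoD) auto
  then obtain n where n: "C powr s * (real N / b powr s) ^ n < e"
    by (meson eventually_sequentially order_refl)
  define U where "U i = (if i < N ^ n then c n i else {})" for i
  have g: "hausdorff_gauge s (U i) \<le> ennreal ((C / b ^ n) powr s)" for i
    using size[of i n] assms(1) diameter_ge_0[of "c n i"]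
    by (auto simp: hausdorff_gauge_def U_def intro!: ennreal_leI powr_mono2)
  have "(\<Sum>i. hausdorff_gauge s (U i)) = (\<Sum>i<N ^ n. hausdorff_gauge s (U i))"
    by (rule suminf_finite) (auto simp: U_def hausdorff_gauge_def)
  also have "\<dots> \<le> (\<Sum>i<N ^ n. ennreal ((C / b ^ n) powr s))"
    by (intro sum_mono g)
  also have "\<dots> = ennreal (real (N ^ n) * (C / b ^ n) powr s)"
    by (simp add: ennreal_mult ennreal_of_nat_eq_real_of_nat del: of_nat_power)
  also have "\<dots> \<le> ennreal e" unfolding eq using n by (intro ennreal_leI) simp
  finally have "(\<Sum>i. hausdorff_gauge s (U i)) \<le> ennreal e" .
  moreover have "A \<subseteq> (\<Union>i. U i)"
  proof
    fix x assume "x \<in> A"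
    then obtain i where "i < N ^ n" "x \<in> c n i" using cover[of n] by blast
    then have "x \<in> U i" by (simp add: U_def)
    then show "x \<in> (\<Union>i. U i)" by blast
  qed
  moreover have "bounded (U i)" for i using size by (simp add: U_def)
  ultimately show "\<exists>U. A \<subseteq> (\<Union>i. U i) \<and> (\<forall>i. bounded (U i)) \<and> (\<Sum>i. hausdorff_gauge s (U i)) \<le> ennreal e"
    by blast
qed fact

lemma square_diameter:
  fixes a b l :: real
  assumes "l \<ge> 0"
  shows "bounded ({a..a + l} \<times> {b..b + l}) \<and> diameter ({a..a + l} \<times> {b..b + l}) \<le> 2 * l"
proof
  show "bounded ({a..a + l} \<times> {b..b + l})" by (intro bounded_Times) auto
  show "diameter ({a..a + l} \<times> {b..b + l}) \<le> 2 * l"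
  proof (rule diameter_le)
    fix x y assume "x \<in> {a..a + l} \<times> {b..b + l}" "y \<in> {a..a + l} \<times> {b..b + l}"
    then have "norm (fst x - fst y) \<le> l" "norm (snd x - snd y) \<le> l" by auto
    then show "norm (x - y) \<le> 2 * l"
      using norm_Pair_le[of "fst x - fst y" "snd x - snd y"] by (simp add: minus_prod_def)
  qed (use assms in simp)
qed

text \<open>Covering by \<open>2 ^ n\<close> squares of side \<open>1 / 2 ^ n\<close> suffices,
  since \<open>2 < 2 powr s\<close>.\<close>

lemma hausdorff_null_segment:
  fixes a s :: real
  assumes "s > 1"
  shows "hausdorff_measure s ({a} \<times> {0..1::real}) = 0" "hausdorff_measure s ({0..1::real} \<times> {a}) = 0"
proof -
  have ex: "\<exists>i<2^n. real i / 2^n \<le> x \<and> x \<le> real i / 2^n + 1 / 2^n" if "x \<in> {0..1}" for x :: real and n :: nat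
  proof (cases "x = 1")
    case True
    have "real (2^n - 1) = 2^n - 1" by (simp add: of_nat_diff)
    with True show ?thesis by (intro exI[of _ "2^n - 1"]) (simp add: field_simps)
  next
    case False
    then have "2^n * x < 2^n" "0 \<le> 2^n * x" using that by auto
    then have "nat \<lfloor>2^n * x\<rfloor> < 2^n" by (simp add: nat_less_iff floor_less_iff)
    moreover have "real (nat \<lfloor>2^n * x\<rfloor>) \<le> 2^n * x" "2^n * x \<le> real (nat \<lfloor>2^n * x\<rfloor>) + 1"
      using \<open>0 \<le> 2^n * x\<close> by linarith+
    ultimately show ?thesis by (intro exI[of _ "nat \<lfloor>2^n * x\<rfloor>"]) (auto simp: field_simps)
  qed
  have cell: "bounded ({u..u + 1/2^n} \<times> {v..v + 1/2^n}) \<and>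
      diameter ({u..u + 1/2^n} \<times> {v..v + 1/2^n}) \<le> 2 / 2 ^ n" for u v :: real and n :: nat
    using square_diameter[of "1/2^n" u v] by simp
  have s: "s > 0" "real 2 < 2 powr s" using assms powr_less_mono[of 1 s 2] by auto
  show "hausdorff_measure s ({a} \<times> {0..1::real}) = 0"
  proof (rule hausdorff_null_geometric[OF s(1) _ _ s(2)])
    show "{a} \<times> {0..1} \<subseteq> (\<Union>i<2^n. {a..a + 1/2^n} \<times> {real i / 2^n..real i / 2^n + 1/2^n})" for n
      using ex[of _ n] by fastforce
  qed (use cell in auto)
  show "hausdorff_measure s ({0..1::real} \<times> {a}) = 0"
  proof (rule hausdorff_null_geometric[OF s(1) _ _ s(2)])
    show "{0..1} \<times> {a} \<subseteq> (\<Union>i<2^n. {real i / 2^n..real i / 2^n + 1/2^n} \<times> {a..a + 1/2^n})" for n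
      using ex[of _ n] by fastforce
  qed (use cell in auto)
qed

section \<open>Pairs of digits of equal parity\<close>

text \<open>For \<open>0 \<le> x < 1\<close> this is the integer formed by the first
  \<open>u\<close> base-\<open>b\<close> digits of \<open>x\<close>.\<close>

definition base_floor :: "nat \<Rightarrow> nat \<Rightarrow> real \<Rightarrow> nat" where
  "base_floor b u x = nat \<lfloor>real b ^ u * x\<rfloor>"

lemma base_floor_bounds:
  assumes "x \<ge> 0"
  shows "real (base_floor b u x) \<le> real b ^ u * x" "real b ^ u * x < real (base_floor b u x) + 1"
proof -
  have "0 \<le> real b ^ u * x" using assms by simp
  then show "real (base_floor b u x) \<le> real b ^ u * x" "real b ^ u * x < real (base_floor b u x) + 1"
    unfolding base_floor_def by linarith+
qed

lemma base_floor_less: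
  assumes "0 \<le> x" "x < 1" "b > 0"
  shows "base_floor b u x < b ^ u"
proof -
  have "real (base_floor b u x) \<le> real b ^ u * x" by (rule base_floor_bounds) fact
  also have "\<dots> < real b ^ u * 1" using assms by (intro mult_strict_left_mono) auto
  finally show ?thesis by (simp flip: of_nat_power)
qed

lemma base_floor_eqI:
  assumes "real m \<le> real b ^ u * x" "real b ^ u * x < real m + 1"
  shows "base_floor b u x = m"
  using assms unfolding base_floor_def by linarith

lemma base_floor_add_div:
  assumes "x \<ge> 0" "b > 0"
  shows "base_floor b (u + s) x div b ^ s = base_floor b u x"
proof -
  have "\<lfloor>real b ^ u * x\<rfloor> = \<lfloor>real b ^ (u + s) * x / real_of_int (int (b ^ s))\<rfloor>"
    using assms by (simp add: power_add)
  also have "\<dots> = \<lfloor>real b ^ (u + s) * x\<rfloor> div int (b ^ s)"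
    by (rule floor_divide_real_eq_div) simp
  finally show ?thesis
    using assms unfolding base_floor_def by (simp add: nat_div_distrib nat_power_eq)
qed

text \<open>The closed intervals from \<open>A u / b ^ u\<close> to \<open>(A u + 1) / b ^ u\<close>
  are nested, and \<open>x\<close> is the supremum of their left ends.\<close>

lemma nested_intervals:
  fixes A :: "nat \<Rightarrow> nat"
  assumes "b > 0" and step: "\<And>u. A (Suc u) div b = A u"
  obtains x :: real where "\<And>u. real (A u) \<le> real b ^ u * x \<and> real b ^ u * x \<le> real (A u) + 1"
proof -
  have div: "A (u + s) div b ^ s = A u" for u s
  proof (induction s)
    case (Suc s)
    have "A (u + Suc s) div b ^ Suc s = A (Suc (u + s)) div b div b ^ s"
      by (simp add: div_mult2_eq)
    then show ?case using Suc step by simp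
  qed simp
  have le: "real (A u) / real b ^ u \<le> (real (A v) + 1) / real b ^ v" for u v
  proof (cases "u \<le> v")
    case True
    then obtain s where v: "v = u + s" using le_Suc_ex by blast
    have "b ^ s * A u \<le> A v" using div[of u s] unfolding v by (metis times_div_less_eq_dividend)
    then have "real (b ^ s * A u) \<le> real (A v)" by (simp only: of_nat_le_iff)
    then have "real b ^ s * real (A u) \<le> real (A v) + 1" by simp
    with assms show ?thesis unfolding v by (simp add: power_add field_simps)
  next
    case False
    then obtain s where u: "u = v + s" using le_Suc_ex by (metis nat_le_linear)
    have "A u div b ^ s < Suc (A v)" using div[of v s] u by simp
    then have "A u < Suc (A v) * b ^ s"
      using assms by (subst (asm) div_less_iff_less_mult) auto
    then have "real (A u) < real (Suc (A v) * b ^ s)" by (simp only: of_nat_less_iff)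
    then have "real (A u) \<le> (real (A v) + 1) * real b ^ s" by (simp add: algebra_simps)
    with assms show ?thesis unfolding u by (simp add: power_add field_simps)
  qed
  define x where "x = (SUP u. real (A u) / real b ^ u)"
  have "bdd_above (range (\<lambda>u. real (A u) / real b ^ u))"
    using le[of _ 0] by (intro bdd_aboveI2)
  then have "real (A u) / real b ^ u \<le> x" for u
    unfolding x_def by (intro cSUP_upper) auto
  moreover have "x \<le> (real (A u) + 1) / real b ^ u" for u
    unfolding x_def by (intro cSUP_least le) simp
  ultimately show ?thesis
    using assms by (intro that[of x]) (auto simp: field_simps)
qed

locale odd_base =
  fixes p :: nat
  assumes p_odd: "odd p" and p_gt_1: "p > 1"
begin

text \<open>There are \<open>(p + 1) / 2\<close> even and \<open>(p - 1) / 2\<close> odd digits; the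
  squares of these two numbers add up to \<open>K\<close>.\<close>

definition K :: nat where
  "K = (p ^ 2 + 1) div 2"

lemma double_K: "2 * K = p ^ 2 + 1"
  using p_odd by (simp add: K_def)

lemma p_less_K: "p < K"
proof -
  obtain h where h: "p = 2 * h + 1" using p_odd by (elim oddE)
  then have "h \<ge> 1" using p_gt_1 by simp
  then have "2 * p < p ^ 2 + 1" unfolding h by (simp add: power2_eq_square algebra_simps)
  then show ?thesis using double_K by linarith
qed

lemma K_pos: "K > 0" using p_less_K by simp

text \<open>As \<open>p\<close> is odd, a number has the parity of its base-\<open>p\<close> digit
  sum. The condition for all \<open>u\<close> thus says that the digits agree in parity at each
  position.\<close>

definition parity_set :: "(real \<times> real) set" where
  "parity_set = {(x, y). 0 \<le> x \<and> x < 1 \<and> 0 \<le> y \<and> y < 1 \<and>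
     (\<forall>u. even (base_floor p u x + base_floor p u y))}"

text \<open>A pair of base-\<open>p\<close> digits \<open>(i, j)\<close> of equal parity is encoded by the base-\<open>K\<close> digit
  \<open>(p i + j) / 2\<close>.\<close>

primrec cell :: "nat \<Rightarrow> nat \<Rightarrow> nat \<times> nat" where
  "cell 0 w = (0, 0)"
| "cell (Suc u) w =
     (p * fst (cell u (w div K)) + 2 * (w mod K) div p,
      p * snd (cell u (w div K)) + 2 * (w mod K) mod p)"

lemma digit_less: "2 * (w mod K) div p < p"
proof -
  have "w mod K < K" using K_pos by simp
  then have "2 * (w mod K) < p * p" using double_K unfolding power2_eq_square by linarith
  then show ?thesis by (rule less_mult_imp_div_less)
qed

lemma cell_Suc_div:
  "fst (cell (Suc u) w) div p = fst (cell u (w div K))"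
  "snd (cell (Suc u) w) div p = snd (cell u (w div K))"
  using digit_less[of w] p_gt_1 by auto

text \<open>The appended digits \<open>i\<close>, \<open>j\<close> satisfy
  \<open>p * i + j = 2 * (w mod K)\<close>, and \<open>p\<close> is odd, so \<open>i + j\<close> is
  even.\<close>

lemma cell_even: "even (fst (cell u w) + snd (cell u w))"
proof (induction u arbitrary: w)
  case (Suc u)
  let ?t = "2 * (w mod K)"
  have "even (p * (?t div p) + ?t mod p)" by simp
  then have "even (?t div p + ?t mod p)" using p_odd by (metis even_add even_mult_iff)
  then show ?case using Suc[of "w div K"] p_odd by (auto simp del: mult_div_mod_eq)
qed simp

lemma inj_on_cell: "inj_on (cell u) {..<K ^ u}"
proof (induction u)
  case (Suc u)
  show ?case
  proof (rule inj_onI)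
    fix w w' assume w: "w \<in> {..<K ^ Suc u}" "w' \<in> {..<K ^ Suc u}" and eq: "cell (Suc u) w = cell (Suc u) w'"
    have "cell u (w div K) = cell u (w' div K)"
      using cell_Suc_div[of u w] cell_Suc_div[of u w'] eq by (intro prod_eqI) metis+
    moreover have "w div K \<in> {..<K ^ u}" "w' div K \<in> {..<K ^ u}"
      using w by (auto simp: less_mult_imp_div_less mult.commute)
    ultimately have 1: "w div K = w' div K" using Suc by (auto dest: inj_onD)
    with eq have "2 * (w mod K) div p = 2 * (w' mod K) div p" "2 * (w mod K) mod p = 2 * (w' mod K) mod p"
      by auto
    then have "2 * (w mod K) = 2 * (w' mod K)" by (metis mult_div_mod_eq)
    then have "w mod K = w' mod K" by simp
    with 1 show "w = w'" by (metis mult_div_mod_eq)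
  qed
qed (simp add: inj_on_def)

lemma cell_surj:
  assumes "m < p ^ u" "n < p ^ u" "\<And>s. s < u \<Longrightarrow> even (m div p ^ s + n div p ^ s)"
  shows "(m, n) \<in> cell u ` {..<K ^ u}"
  using assms
proof (induction u arbitrary: m n)
  case (Suc u)
  have "(m div p, n div p) \<in> cell u ` {..<K ^ u}"
  proof (rule Suc.IH)
    show "m div p < p ^ u" "n div p < p ^ u"
      using Suc.prems by (auto simp: less_mult_imp_div_less mult.commute)
    show "even (m div p div p ^ s + n div p div p ^ s)" if "s < u" for s
      using Suc.prems(3)[of "Suc s"] that by (simp add: div_mult2_eq)
  qed
  then obtain w where w: "w < K ^ u" "cell u w = (m div p, n div p)" by auto
  \<comment> \<open>The last digits agree in parity because \<open>m\<close>, \<open>n\<close> and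
    their quotients by \<open>p\<close> do. So \<open>t\<close> is even, and its half is the
    base-\<open>K\<close> digit to append.\<close>
  define t where "t = p * (m mod p) + n mod p"
  have lt: "m mod p < p" "n mod p < p" using p_gt_1 by auto
  have "even (m + n)" using Suc.prems(3)[of 0] by simp
  moreover have "even m \<longleftrightarrow> (even (m div p) \<longleftrightarrow> even (m mod p))" "even n \<longleftrightarrow> (even (n div p) \<longleftrightarrow> even (n mod p))"
    using p_odd by (metis even_add even_mult_iff mult_div_mod_eq)+
  moreover have "even (m div p + n div p)"
    using cell_even[of u w] w by simp
  ultimately have "even t" using p_odd by (auto simp: t_def)
  then obtain v where v: "t = 2 * v" by (elim evenE)
  have "t < p * (m mod p) + p * 1" using lt by (simp add: t_def)
  also have "\<dots> = p * (m mod p + 1)" by (simp add: algebra_simps)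
  also have "\<dots> \<le> p * p" by (rule mult_le_mono2) (use lt(1) in linarith)
  finally have vK: "v < K" using double_K v by (simp add: power2_eq_square)
  have "t div p = m mod p" "t mod p = n mod p" using lt by (auto simp: t_def)
  moreover have "(K * w + v) div K = w" "(K * w + v) mod K = v" using vK by auto
  ultimately have "cell (Suc u) (K * w + v) = (m, n)"
    using w v by simp
  moreover have "K * w + v < K ^ Suc u"
  proof -
    have "K * w + v < K * (w + 1)" using vK by simp
    also have "\<dots> \<le> K * K ^ u" using w by (intro mult_le_mono) auto
    finally show ?thesis by simp
  qed
  ultimately show ?case by (intro image_eqI[of _ _ "K * w + v"]) auto
qed simp

lemma parity_set_null:
  assumes "real K < real p powr s" "s > 0"
  shows "hausdorff_measure s parity_set = 0"
proof (rule hausdorff_null_geometric[OF assms(2) _ _ assms(1)])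
  let ?c = "\<lambda>u w. {real (fst (cell u w)) / real p ^ u..real (fst (cell u w)) / real p ^ u + 1 / real p ^ u} \<times>
    {real (snd (cell u w)) / real p ^ u..real (snd (cell u w)) / real p ^ u + 1 / real p ^ u}"
  show "real p > 0" using p_gt_1 by simp
  show "bounded (?c u w) \<and> diameter (?c u w) \<le> 2 / real p ^ u" for u w
    using square_diameter[of "1 / real p ^ u"] by simp
  show "parity_set \<subseteq> (\<Union>w<K ^ u. ?c u w)" for u
  proof
    fix z assume "z \<in> parity_set"
    then obtain x y where z: "z = (x, y)" and xy: "0 \<le> x" "x < 1" "0 \<le> y" "y < 1"
      and ev: "\<And>u. even (base_floor p u x + base_floor p u y)" by (auto simp: parity_set_def)
    have "(base_floor p u x, base_floor p u y) \<in> cell u ` {..<K ^ u}"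
    proof (rule cell_surj)
      show "base_floor p u x < p ^ u" "base_floor p u y < p ^ u"
        using xy p_gt_1 by (auto intro: base_floor_less)
      fix s assume "s < u"
      then show "even (base_floor p u x div p ^ s + base_floor p u y div p ^ s)"
        using base_floor_add_div[of _ p "u - s" s] ev[of "u - s"] xy p_gt_1 by simp
    qed
    then obtain w where w: "w < K ^ u" "cell u w = (base_floor p u x, base_floor p u y)" by auto
    have "real (base_floor p u v) / real p ^ u \<le> v"
      "v \<le> real (base_floor p u v) / real p ^ u + 1 / real p ^ u" if "v \<ge> 0" for v
      using base_floor_bounds[OF that, of p u] p_gt_1 by (auto simp: field_simps)
    then have "z \<in> ?c u w" using xy w by (simp add: z)
    with w show "z \<in> (\<Union>w<K ^ u. ?c u w)" by blast
  qed
qed simp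

section \<open>Lower bound by transport of Lebesgue measure\<close>

text \<open>A coordinate \<open>j / p ^ u\<close> is where base-\<open>p\<close> expansions can be
  ambiguous. Both the image of a coding and the limit set differ from \<open>parity_set\<close> only
  by such points.\<close>

definition lattice_lines :: "(real \<times> real) set" where
  "lattice_lines = (\<Union>(j, u). {real j / real p ^ u} \<times> {0..1} \<union> {0..1} \<times> {real j / real p ^ u})"

lemma lattice_lines_null:
  assumes "s > 1"
  shows "hausdorff_measure s lattice_lines = 0"
  unfolding lattice_lines_def using assms
  by (intro hausdorff_null_UN) (auto intro!: hausdorff_null_Un hausdorff_null_segment split: prod.split)

text \<open>The map \<open>g\<close> replaces the base-\<open>K\<close> digits of \<open>t\<close> by the encoded pairs of base-\<open>p\<close> digits.
  Both inequalities are non-strict because the digit \<open>p - 1\<close> may repeat forever.\<close>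

definition coding :: "(real \<Rightarrow> real \<times> real) \<Rightarrow> bool" where
  "coding g \<longleftrightarrow> (\<forall>t\<ge>0. \<forall>u.
     real (fst (cell u (base_floor K u t))) \<le> real p ^ u * fst (g t) \<and>
     real p ^ u * fst (g t) \<le> real (fst (cell u (base_floor K u t))) + 1 \<and>
     real (snd (cell u (base_floor K u t))) \<le> real p ^ u * snd (g t) \<and>
     real p ^ u * snd (g t) \<le> real (snd (cell u (base_floor K u t))) + 1)"

lemma coding_exists:
  obtains g where "coding g"
proof -
  let ?P = "\<lambda>f t x. \<forall>u. real (f (cell u (base_floor K u t))) \<le> real p ^ u * x \<and>
       real p ^ u * x \<le> real (f (cell u (base_floor K u t))) + 1"
  have K_step: "base_floor K (Suc u) t div K = base_floor K u t" if "t \<ge> 0" for t u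
    using base_floor_add_div[OF that K_pos, of u 1] by simp
  have "\<exists>x. ?P fst t x" if "t \<ge> 0" for t
  proof (rule nested_intervals[of p "\<lambda>u. fst (cell u (base_floor K u t))"])
    show "fst (cell (Suc u) (base_floor K (Suc u) t)) div p = fst (cell u (base_floor K u t))" for u
      by (simp only: cell_Suc_div K_step[OF that])
  qed (use p_gt_1 in auto)
  moreover have "\<exists>x. ?P snd t x" if "t \<ge> 0" for t
  proof (rule nested_intervals[of p "\<lambda>u. snd (cell u (base_floor K u t))"])
    show "snd (cell (Suc u) (base_floor K (Suc u) t)) div p = snd (cell u (base_floor K u t))" for u
      by (simp only: cell_Suc_div K_step[OF that])
  qed (use p_gt_1 in auto)
  ultimately obtain g1 g2 where "\<And>t. t \<ge> 0 \<Longrightarrow> ?P fst t (g1 t)" "\<And>t. t \<ge> 0 \<Longrightarrow> ?P snd t (g2 t)"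
    by metis
  then show ?thesis by (intro that[of "\<lambda>t. (g1 t, g2 t)"]) (auto simp: coding_def)
qed

text \<open>Off the lattice lines the upper bounds are strict, so the cell coordinates are the
  floors, and \<open>cell_even\<close> applies.\<close>

lemma coding_in_parity_set:
  fixes x y :: real and w :: "nat \<Rightarrow> nat"
  assumes x: "\<And>u. real (fst (cell u (w u))) \<le> real p ^ u * x \<and> real p ^ u * x \<le> real (fst (cell u (w u))) + 1"
    and y: "\<And>u. real (snd (cell u (w u))) \<le> real p ^ u * y \<and> real p ^ u * y \<le> real (snd (cell u (w u))) + 1"
  shows "(x, y) \<in> parity_set \<union> lattice_lines"
proof (cases "\<exists>j u. real p ^ u * x = real j \<or> real p ^ u * y = real j")
  case True
  have "0 \<le> x" "x \<le> 1" "0 \<le> y" "y \<le> 1" using x[of 0] y[of 0] by auto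
  moreover have "v = real j / real p ^ u" if "real p ^ u * v = real j" for v j u
    using that p_gt_1 by (simp add: field_simps)
  ultimately have "(x, y) \<in> lattice_lines"
    using True unfolding lattice_lines_def by fastforce
  then show ?thesis by simp
next
  case False
  have ne: "real p ^ u * x \<noteq> real (fst (cell u (w u)) + 1)" "real p ^ u * y \<noteq> real (snd (cell u (w u)) + 1)" for u
    using False by blast+
  have "base_floor p u x = fst (cell u (w u))" "base_floor p u y = snd (cell u (w u))" for u
    using x[of u] y[of u] ne[of u] by (intro base_floor_eqI; linarith)+
  then have "even (base_floor p u x + base_floor p u y)" for u
    using cell_even[of u "w u"] by simp
  \<comment> \<open>Taking \<open>u = 0\<close> and \<open>j = 1\<close> excludes the coordinate
    1.\<close>
  moreover have "0 \<le> x" "x < 1" "0 \<le> y" "y < 1"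
    using x[of 0] y[of 0] False[simplified, rule_format, of 0 1] by (auto simp: less_le)
  ultimately have "(x, y) \<in> parity_set" by (simp add: parity_set_def)
  then show ?thesis by simp
qed

text \<open>Few cells of level \<open>u\<close> meet a set of this diameter, and each cell comes
  from one interval of length \<open>1 / K ^ u\<close>. As \<open>U\<close> is arbitrary, its
  preimage is enclosed in a Borel set rather than measured.\<close>

lemma preimage_cover:
  assumes g: "coding g"
    and U: "bounded U" "diameter U \<le> 1 / real p ^ u"
  shows "\<exists>B\<in>sets lborel. {t\<in>{0..<1}. g t \<in> U} \<subseteq> B \<and> emeasure lborel B \<le> ennreal (25 / real K ^ u)"
proof (cases "{t\<in>{0..<1}. g t \<in> U} = {}")
  case True
  then show ?thesis by (intro bexI[of _ "{}"]) auto
next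
  case False
  then obtain t0 where t0: "t0 \<in> {0..<1}" "g t0 \<in> U" by blast
  define a b where "a = fst (cell u (base_floor K u t0))" and "b = snd (cell u (base_floor K u t0))"
  \<comment> \<open>After scaling by \<open>p ^ u\<close> the points are at most 1 apart in each
    coordinate, and cells have side 1, so cell coordinates differ by at most 2. That allows
    \<open>5 * 5 = 25\<close> cells.\<close>
  define W where "W = {w \<in> {..<K ^ u}. cell u w \<in> {a - 2..a + 2} \<times> {b - 2..b + 2}}"
  define I where "I w = {real w / real K ^ u..<(real w + 1) / real K ^ u}" for w
  have Kp: "real K ^ u > 0" and pp: "real p ^ u > 0" using K_pos p_gt_1 by auto
  have "{t\<in>{0..<1}. g t \<in> U} \<subseteq> (\<Union>w\<in>W. I w)"
  proof clarify
    fix t :: real assume t: "t \<in> {0..<1}" "g t \<in> U"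
    define w where "w = base_floor K u t"
    have "dist (g t) (g t0) \<le> 1 / real p ^ u"
      using diameter_bounded_bound[OF U(1) t(2) t0(2)] U(2) by simp
    then have "\<bar>fst (g t) - fst (g t0)\<bar> \<le> 1 / real p ^ u" "\<bar>snd (g t) - snd (g t0)\<bar> \<le> 1 / real p ^ u"
      using dist_fst_le[of "g t" "g t0"] dist_snd_le[of "g t" "g t0"] by (simp_all add: dist_real_def)
    then have "real p ^ u * \<bar>fst (g t) - fst (g t0)\<bar> \<le> 1" "real p ^ u * \<bar>snd (g t) - snd (g t0)\<bar> \<le> 1"
      using pp by (simp_all add: pos_le_divide_eq mult.commute)
    moreover have "\<bar>real p ^ u * c - real p ^ u * d\<bar> = real p ^ u * \<bar>c - d\<bar>" for c d
      using pp by (simp add: abs_mult flip: right_diff_distrib)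
    ultimately have close: "\<bar>real p ^ u * fst (g t) - real p ^ u * fst (g t0)\<bar> \<le> 1"
      "\<bar>real p ^ u * snd (g t) - real p ^ u * snd (g t0)\<bar> \<le> 1"
      by simp_all
    have "real (fst (cell u w)) \<le> real a + 2" "real a \<le> real (fst (cell u w)) + 2"
      "real (snd (cell u w)) \<le> real b + 2" "real b \<le> real (snd (cell u w)) + 2"
      using close g[unfolded coding_def, rule_format, of t u] g[unfolded coding_def, rule_format, of t0 u] t t0
      unfolding a_def b_def w_def by auto
    then have "cell u w \<in> {a - 2..a + 2} \<times> {b - 2..b + 2}"
      by (auto simp: mem_Times_iff)
    moreover have "w < K ^ u" using base_floor_less[of t K u] t K_pos by (simp add: w_def)
    ultimately have "w \<in> W" by (simp add: W_def)
    moreover have "t \<in> I w"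
      using base_floor_bounds[of t K u] t Kp by (auto simp: I_def w_def field_simps)
    ultimately show "t \<in> (\<Union>w\<in>W. I w)" by blast
  qed
  moreover have "emeasure lborel (\<Union>w\<in>W. I w) \<le> ennreal (25 / real K ^ u)"
  proof -
    have "card W = card (cell u ` W)"
      by (intro card_image[symmetric] inj_on_subset[OF inj_on_cell]) (auto simp: W_def)
    also have "\<dots> \<le> card ({a - 2..a + 2} \<times> {b - 2..b + 2})"
      by (intro card_mono) (auto simp: W_def)
    also have "\<dots> \<le> 5 * 5"
      unfolding card_cartesian_product by (intro mult_le_mono) auto
    finally have card: "card W \<le> 25" by simp
    have "emeasure lborel (\<Union>w\<in>W. I w) \<le> (\<Sum>w\<in>W. emeasure lborel (I w))"
      by (intro emeasure_subadditive_finite) (auto simp: W_def I_def)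
    also have "\<dots> = (\<Sum>w\<in>W. ennreal (1 / real K ^ u))"
      using Kp by (intro sum.cong) (auto simp: I_def divide_right_mono simp flip: diff_divide_distrib)
    also have "\<dots> = ennreal (real (card W) * (1 / real K ^ u))"
      unfolding sum_constant ennreal_of_nat_eq_real_of_nat by (rule ennreal_mult[symmetric]) simp_all
    also have "\<dots> \<le> ennreal (25 / real K ^ u)"
      using card Kp by (intro ennreal_leI) (simp add: divide_right_mono)
    finally show ?thesis .
  qed
  ultimately show ?thesis
    by (intro bexI[of _ "\<Union>w\<in>W. I w"]) (auto simp: I_def W_def)
qed

definition dim :: real where
  "dim = ln (real K) / ln (real p)"

lemma powr_dim: "real p powr dim = real K"
  using p_gt_1 K_pos by (simp add: dim_def powr_def)

lemma dim_gt_1: "dim > 1"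
  using p_less_K p_gt_1 by (simp add: dim_def)

text \<open>The diameter is compared with powers of \<open>1 / p\<close>; rounding to the next power
  costs the factor \<open>K = p powr dim\<close>.\<close>

lemma preimage_cover_gauge:
  assumes g: "coding g"
    and U: "bounded U" "diameter U \<le> 1"
  shows "\<exists>B\<in>sets lborel. {t\<in>{0..<1}. g t \<in> U} \<subseteq> B \<and>
     emeasure lborel B \<le> ennreal (25 * real K) * hausdorff_gauge dim U"
proof -
  note cover = preimage_cover[OF g U(1)]
  have K1: "real K > 1" using p_less_K p_gt_1 by simp
  consider "U = {}" | "U \<noteq> {}" "diameter U = 0" | "U \<noteq> {}" "diameter U > 0"
    using diameter_ge_0[OF U(1)] by linarith
  then show ?thesis
  proof cases
    case 1
    then show ?thesis by (intro bexI[of _ "{}"]) auto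
  next
    case 2
    \<comment> \<open>The gauge is 0, so a null set is needed: the covers of all levels are
      intersected.\<close>
    then have "\<forall>u. \<exists>B. B \<in> sets lborel \<and> {t\<in>{0..<1}. g t \<in> U} \<subseteq> B \<and>
        emeasure lborel B \<le> ennreal (25 / real K ^ u)"
      using cover by (simp add: Bex_def)
    from choice[OF this] obtain B where "\<forall>u. B u \<in> sets lborel \<and> {t\<in>{0..<1}. g t \<in> U} \<subseteq> B u \<and>
        emeasure lborel (B u) \<le> ennreal (25 / real K ^ u)" by (rule exE)
    then have B: "B u \<in> sets lborel" "{t\<in>{0..<1}. g t \<in> U} \<subseteq> B u"
      "emeasure lborel (B u) \<le> ennreal (25 / real K ^ u)" for u by simp_all
    have "emeasure lborel (\<Inter>u. B u) \<le> ennreal (25 / real K ^ u)" for u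
      using emeasure_mono[of "\<Inter>u. B u" "B u" lborel] B(1,3) by (meson INT_lower UNIV_I order_trans)
    moreover have "(\<lambda>u. ennreal (25 / real K ^ u)) \<longlonglongrightarrow> ennreal 0"
      using LIMSEQ_divide_realpow_zero[OF K1, of 25] by (rule tendsto_ennrealI)
    ultimately have "emeasure lborel (\<Inter>u. B u) \<le> ennreal 0"
      by (intro LIMSEQ_le_const[of _ "ennreal 0"]) blast+
    then show ?thesis
      using B(1,2) by (intro bexI[of _ "\<Inter>u. B u"]) (auto intro!: sets.countable_INT)
  next
    case 3
    have p1: "1 / real p < 1" "1 / real p > 0" using p_gt_1 by auto
    \<comment> \<open>This \<open>u\<close> gives
      \<open>(1 / p) ^ Suc u < diameter U \<le> (1 / p) ^ u\<close>; minimality yields the upper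
      bound, and \<open>diameter U \<le> 1\<close> does so for \<open>u = 0\<close>.\<close>
    define u where "u = (LEAST u. (1 / real p) ^ Suc u < diameter U)"
    have "\<exists>u. (1 / real p) ^ Suc u < diameter U"
    proof -
      obtain u where u: "(1 / real p) ^ u < diameter U" using real_arch_pow_inv[OF 3(2) p1(1)] by blast
      have "(1 / real p) ^ Suc u \<le> (1 / real p) ^ u" using p1 by (intro power_decreasing) auto
      with u show ?thesis by (intro exI[of _ u]) linarith
    qed
    then have lower: "(1 / real p) ^ Suc u < diameter U" unfolding u_def by (rule LeastI_ex)
    have "diameter U \<le> (1 / real p) ^ u"
    proof (cases u)
      case (Suc v)
      then have "\<not> (1 / real p) ^ Suc v < diameter U" unfolding u_def by (intro not_less_Least) simp
      with Suc show ?thesis by simp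
    qed (use U(2) in simp)
    then have "diameter U \<le> 1 / real p ^ u" by (simp add: power_one_over)
    from cover[OF this] obtain B where B: "B \<in> sets lborel" "{t\<in>{0..<1}. g t \<in> U} \<subseteq> B"
      "emeasure lborel B \<le> ennreal (25 / real K ^ u)" by blast
    have "1 / real K ^ Suc u = ((1 / real p) ^ Suc u) powr dim"
      using p_gt_1 by (simp add: powr_dim[symmetric] power_one_over powr_divide powr_powr powr_mult
          powr_realpow[symmetric] powr_add[symmetric] algebra_simps)
    also have "\<dots> \<le> diameter U powr dim"
      using lower p1 dim_gt_1 by (intro powr_mono2) auto
    finally have "25 / real K ^ u \<le> 25 * real K * diameter U powr dim"
      using K1 by (simp add: field_simps)
    then have "ennreal (25 / real K ^ u) \<le> ennreal (25 * real K) * hausdorff_gauge dim U"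
      using 3 dim_gt_1 by (auto simp: hausdorff_gauge_def ennreal_leI simp flip: ennreal_mult)
    with B show ?thesis by (intro bexI[of _ B]) auto
  qed
qed

text \<open>The mass distribution argument: a cover of the image of \<open>g\<close> with small
  total gauge would pull back to a cover of \<open>{0..<1}\<close> of measure below 1.\<close>

lemma parity_set_not_null: "hausdorff_measure dim parity_set \<noteq> 0"
proof
  assume null: "hausdorff_measure dim parity_set = 0"
  obtain g where g: "coding g" by (rule coding_exists)
  have "g ` {0..<1} \<subseteq> parity_set \<union> lattice_lines"
  proof
    fix z assume "z \<in> g ` {0..<1}"
    then obtain t where "t \<in> {0..<1}" "z = g t" by blast
    then have "(fst z, snd z) \<in> parity_set \<union> lattice_lines"
      using g by (intro coding_in_parity_set[of "\<lambda>u. base_floor K u t"]) (auto simp: coding_def)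
    then show "z \<in> parity_set \<union> lattice_lines" by simp
  qed
  moreover have "hausdorff_measure dim (parity_set \<union> lattice_lines) = 0"
    using null lattice_lines_null dim_gt_1 by (intro hausdorff_null_Un) auto
  ultimately have null: "hausdorff_measure dim (g ` {0..<1}) = 0"
    by (metis hausdorff_null_subset)
  \<comment> \<open>Chosen so that \<open>25 * K * e = 1 / 2\<close>.\<close>
  define e where "e = 1 / (50 * real K)"
  have "e > 0" using K_pos by (simp add: e_def)
  then obtain U where U: "g ` {0..<1} \<subseteq> (\<Union>i. U i)" "\<And>i. bounded (U i)" "\<And>i. diameter (U i) \<le> 1"
    "(\<Sum>i. hausdorff_gauge dim (U i)) < ennreal e"
    by (rule hausdorff_nullD[OF null]) blast
  have "\<forall>i. \<exists>B. B \<in> sets lborel \<and> {t\<in>{0..<1}. g t \<in> U i} \<subseteq> B \<and>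
     emeasure lborel B \<le> ennreal (25 * real K) * hausdorff_gauge dim (U i)"
    using preimage_cover_gauge[OF g U(2,3)] by blast
  from choice[OF this] obtain B where "\<forall>i. B i \<in> sets lborel \<and> {t\<in>{0..<1}. g t \<in> U i} \<subseteq> B i \<and>
     emeasure lborel (B i) \<le> ennreal (25 * real K) * hausdorff_gauge dim (U i)" by (rule exE)
  then have B: "B i \<in> sets lborel" "{t\<in>{0..<1}. g t \<in> U i} \<subseteq> B i"
    "emeasure lborel (B i) \<le> ennreal (25 * real K) * hausdorff_gauge dim (U i)" for i by simp_all
  have "{0..<1} \<subseteq> (\<Union>i. B i)"
  proof
    fix t :: real assume t: "t \<in> {0..<1}"
    then obtain i where "g t \<in> U i" using U(1) by blast
    with t B(2)[of i] show "t \<in> (\<Union>i. B i)" by blast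
  qed
  then have "emeasure lborel {0..<1::real} \<le> emeasure lborel (\<Union>i. B i)"
    using B(1) by (intro emeasure_mono) auto
  also have "\<dots> \<le> (\<Sum>i. emeasure lborel (B i))"
    using B(1) by (intro emeasure_subadditive_countably) auto
  also have "\<dots> \<le> (\<Sum>i. ennreal (25 * real K) * hausdorff_gauge dim (U i))"
    using B(3) by (intro suminf_le summableI)
  also have "\<dots> = ennreal (25 * real K) * (\<Sum>i. hausdorff_gauge dim (U i))"
    by (rule ennreal_suminf_cmult)
  also have "\<dots> \<le> ennreal (25 * real K) * ennreal e"
    using U(4) by (intro mult_left_mono) auto
  also have "\<dots> = ennreal (1 / 2)"
    using K_pos by (simp add: e_def flip: ennreal_mult)
  finally have "ennreal 1 \<le> ennreal (1 / 2)"
    by (simp only: emeasure_lborel_Ico zero_le_one diff_zero)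
  then show False by (subst (asm) ennreal_le_iff) simp_all
qed

text \<open>Nullity holds above \<open>dim\<close> and fails at \<open>dim\<close>; since it passes
  to larger exponents, it also fails below.\<close>

lemma hausdorff_dim_eqI:
  assumes "parity_set \<subseteq> A" "A \<subseteq> parity_set \<union> lattice_lines"
  shows "hausdorff_dim A = ereal dim"
proof -
  have null: "hausdorff_measure s A = 0" if "s > dim" for s
  proof -
    have "real K < real p powr s"
      using powr_less_mono[OF that, of "real p"] p_gt_1 by (simp add: powr_dim)
    then have "hausdorff_measure s (parity_set \<union> lattice_lines) = 0"
      using that dim_gt_1 by (intro hausdorff_null_Un parity_set_null lattice_lines_null) auto
    then show ?thesis using assms(2) by (rule hausdorff_null_subset)
  qed
  have ge: "dim \<le> s" if "0 \<le> s" "hausdorff_measure s A = 0" for s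
  proof (rule ccontr)
    assume "\<not> dim \<le> s"
    then have "hausdorff_measure dim A = 0"
      using that dim_gt_1 by (intro hausdorff_null_exponent_mono[OF that(2,1)]) auto
    then show False using hausdorff_null_subset[OF _ assms(1)] parity_set_not_null by blast
  qed
  show ?thesis
  proof (rule antisym)
    show "hausdorff_dim A \<le> ereal dim"
    proof (rule ereal_le_epsilon2)
      fix e :: real assume "e > 0"
      then have "ereal (dim + e) \<in> {ereal s |s. 0 \<le> s \<and> hausdorff_measure s A = 0}"
        using null[of "dim + e"] dim_gt_1 by auto
      then show "hausdorff_dim A \<le> ereal dim + ereal e"
        unfolding hausdorff_dim_def by (intro Inf_lower) simp
    qed
    show "ereal dim \<le> hausdorff_dim A"
      unfolding hausdorff_dim_def using ge by (intro Inf_greatest) auto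
  qed
qed

end

section \<open>The limit set\<close>

text \<open>The half-open squares of level \<open>r\<close> are the sets on which both floors are
  constant.\<close>

lemma mem_cantor_J_iff:
  assumes "p > 0"
  shows "(x, y) \<in> cantor_J p r \<longleftrightarrow> 0 \<le> x \<and> x < 1 \<and> 0 \<le> y \<and> y < 1 \<and>
     cantor_wall p r (base_floor p r x) (base_floor p r y) \<noteq> 0"
proof -
  have pp: "real p ^ r > 0" using assms by simp
  have cell: "v \<in> {real m / real p ^ r..<(real m + 1) / real p ^ r} \<longleftrightarrow> v \<ge> 0 \<and> base_floor p r v = m" for v m
  proof
    assume v: "v \<in> {real m / real p ^ r..<(real m + 1) / real p ^ r}"
    then have "0 \<le> real m / real p ^ r" "real m / real p ^ r \<le> v" by auto
    then have "v \<ge> 0" by linarith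
    moreover have "base_floor p r v = m"
      using v pp by (intro base_floor_eqI) (auto simp: field_simps)
    ultimately show "v \<ge> 0 \<and> base_floor p r v = m" ..
  next
    assume "v \<ge> 0 \<and> base_floor p r v = m"
    then show "v \<in> {real m / real p ^ r..<(real m + 1) / real p ^ r}"
      using base_floor_bounds[of v p r] pp by (auto simp: field_simps)
  qed
  have lt: "base_floor p r v < p ^ r \<longleftrightarrow> v < 1" if "v \<ge> 0" for v
  proof
    assume "base_floor p r v < p ^ r"
    then have "real (base_floor p r v) + 1 \<le> real (p ^ r)"
      using of_nat_le_iff[of "base_floor p r v + 1" "p ^ r", where ?'a = real] by simp
    then have "real p ^ r * v < real p ^ r * 1"
      using base_floor_bounds(2)[OF that, of p r] by simp
    then show "v < 1" using pp by simp
  qed (use base_floor_less that assms in blast)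
  have "(x, y) \<in> cantor_J p r \<longleftrightarrow> (\<exists>m n. m < p ^ r \<and> n < p ^ r \<and> cantor_wall p r m n \<noteq> 0 \<and>
      x \<in> {real m / real p ^ r..<(real m + 1) / real p ^ r} \<and>
      y \<in> {real n / real p ^ r..<(real n + 1) / real p ^ r})"
    unfolding cantor_J_def by (auto simp del: atLeastLessThan_iff)
  also have "\<dots> \<longleftrightarrow> 0 \<le> x \<and> x < 1 \<and> 0 \<le> y \<and> y < 1 \<and>
     cantor_wall p r (base_floor p r x) (base_floor p r y) \<noteq> 0"
    unfolding cell using lt[of x] lt[of y] by auto
  finally show ?thesis .
qed

context odd_base
begin

lemma parity_set_subset_cantor_F:
  assumes "prime p"
  shows "parity_set \<subseteq> cantor_F p"
proof
  fix z assume "z \<in> parity_set"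
  then obtain x y where z: "z = (x, y)" and xy: "0 \<le> x" "x < 1" "0 \<le> y" "y < 1"
    and ev: "\<And>u. even (base_floor p u x + base_floor p u y)" by (auto simp: parity_set_def)
  have "cantor_wall p r (base_floor p r x) (base_floor p r y) \<noteq> 0" for r
  proof (rule cantor_wall_nonzero[OF assms p_odd])
    show "base_floor p r x < p ^ r" "base_floor p r y < p ^ r"
      using xy p_gt_1 by (auto intro: base_floor_less)
    fix s assume "s < r"
    then show "even (base_floor p r x div p ^ s + base_floor p r y div p ^ s)"
      using base_floor_add_div[of _ p "r - s" s] ev[of "r - s"] xy p_gt_1 by simp
  qed
  then show "z \<in> cantor_F p"
    using xy p_gt_1 by (simp add: z cantor_F_def mem_cantor_J_iff)
qed

text \<open>If the \<open>s\<close> digits of \<open>x\<close> after position \<open>u\<close> are all \<open>0\<close> or all \<open>p - 1\<close>, then \<open>p\<^sup>u x\<close> is within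
  \<open>p\<^bsup>-s\<^esup>\<close> of an integer.\<close>

lemma boundary_frac:
  assumes "x \<ge> 0" "base_floor p (u + s) x mod p ^ s \<in> {0, p ^ s - 1}"
  shows "min (frac (real p ^ u * x)) (1 - frac (real p ^ u * x)) \<le> (1 / real p) ^ s"
proof -
  let ?a = "base_floor p u x" and ?m = "base_floor p (u + s) x"
  have pp: "real p ^ s > 0" using p_gt_1 by simp
  have a: "real ?a = of_int \<lfloor>real p ^ u * x\<rfloor>"
    using assms(1) by (simp add: base_floor_def)
  have "?m div p ^ s = ?a"
    using assms(1) p_gt_1 by (intro base_floor_add_div) auto
  then have m: "?m = p ^ s * ?a + ?m mod p ^ s"
    by (metis mult_div_mod_eq)
  have split: "real p ^ (u + s) * x = real p ^ s * (real ?a + frac (real p ^ u * x))"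
    unfolding a frac_def by (simp add: power_add)
  note bounds = base_floor_bounds[OF assms(1), of p "u + s"]
  have "real p ^ s * frac (real p ^ u * x) \<le> 1 \<or> real p ^ s * (1 - frac (real p ^ u * x)) \<le> 1"
  proof (cases "?m mod p ^ s = 0")
    case True
    with m have "real ?m = real (p ^ s * ?a)" by simp
    then show ?thesis using bounds(2) unfolding split by (simp add: algebra_simps)
  next
    case False
    with assms(2) m have "?m + 1 = p ^ s * ?a + p ^ s" using p_gt_1 by auto
    then have "real (?m + 1) = real (p ^ s * ?a + p ^ s)" by simp
    then show ?thesis using bounds(1) unfolding split by (simp add: algebra_simps)
  qed
  then show ?thesis using pp by (auto simp: power_one_over min_le_iff_disj field_simps)
qed

text \<open>If the floors at level \<open>u\<close> differ in parity, the walls of levels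
  \<open>u + s\<close> force, for every \<open>s \<ge> 2\<close>, one of \<open>p ^ u * x\<close>
  and \<open>p ^ u * y\<close> to be within \<open>(1 / p) ^ s\<close> of an integer. In the limit
  one of them is an integer.\<close>

lemma cantor_F_subset:
  assumes "prime p"
  shows "cantor_F p \<subseteq> parity_set \<union> lattice_lines"
proof
  fix z assume "z \<in> cantor_F p"
  obtain x y where z: "z = (x, y)" by (cases z)
  have J: "(x, y) \<in> cantor_J p r" for r using \<open>z \<in> cantor_F p\<close> by (simp add: z cantor_F_def)
  then have xy: "0 \<le> x" "x < 1" "0 \<le> y" "y < 1"
    and wall: "\<And>r. cantor_wall p r (base_floor p r x) (base_floor p r y) \<noteq> 0"
    using p_gt_1 by (auto simp: mem_cantor_J_iff)
  show "z \<in> parity_set \<union> lattice_lines"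
  proof (cases "\<forall>u. even (base_floor p u x + base_floor p u y)")
    case True
    then show ?thesis using xy by (simp add: z parity_set_def)
  next
    case False
    then obtain u where u: "odd (base_floor p u x + base_floor p u y)" by blast
    \<comment> \<open>This makes \<open>s < u + s\<close>, as \<open>cantor_wall_nonzero_imp\<close>
      requires at level \<open>u + s\<close>.\<close>
    have "u \<noteq> 0"
    proof
      assume "u = 0"
      then have "base_floor p u x = 0" "base_floor p u y = 0"
        using base_floor_less[of _ p 0] xy p_gt_1 by auto
      with u show False by simp
    qed
    \<comment> \<open>The distance from \<open>p ^ u * v\<close> to the nearest integer. The minimum
      over both coordinates is taken since the coordinate that is close may change with
      \<open>s\<close>.\<close>
    define d where "d v = min (frac (real p ^ u * v)) (1 - frac (real p ^ u * v))" for v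
    have small: "min (d x) (d y) \<le> (1 / real p) ^ s" if "s \<ge> 2" for s
    proof -
      let ?m = "base_floor p (u + s) x" and ?n = "base_floor p (u + s) y"
      have "even (?m div p ^ s + ?n div p ^ s) \<or> ?m mod p ^ s \<in> {0, p ^ s - 1} \<or> ?n mod p ^ s \<in> {0, p ^ s - 1}"
        using xy p_gt_1 that \<open>u \<noteq> 0\<close>
        by (intro cantor_wall_nonzero_imp[OF assms p_odd _ _ wall[of "u + s"]] base_floor_less) auto
      moreover have "odd (?m div p ^ s + ?n div p ^ s)"
        using u base_floor_add_div[of _ p u s] xy p_gt_1 by simp
      moreover have "d x \<le> (1 / real p) ^ s" if "?m mod p ^ s \<in> {0, p ^ s - 1}"
        using boundary_frac[OF xy(1) that] by (simp only: d_def)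
      moreover have "d y \<le> (1 / real p) ^ s" if "?n mod p ^ s \<in> {0, p ^ s - 1}"
        using boundary_frac[OF xy(3) that] by (simp only: d_def)
      ultimately have "d x \<le> (1 / real p) ^ s \<or> d y \<le> (1 / real p) ^ s" by argo
      then show ?thesis by auto
    qed
    have "(\<lambda>s. (1 / real p) ^ s) \<longlonglongrightarrow> 0"
      using p_gt_1 by (intro LIMSEQ_realpow_zero) auto
    then have "min (d x) (d y) \<le> 0"
      using small by (intro LIMSEQ_le_const[of _ 0]) blast+
    then have "frac (real p ^ u * x) = 0 \<or> frac (real p ^ u * y) = 0"
      using frac_lt_1[of "real p ^ u * x"] frac_lt_1[of "real p ^ u * y"]
        frac_ge_0[of "real p ^ u * x"] frac_ge_0[of "real p ^ u * y"]
      unfolding d_def min_le_iff_disj by linarith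
    moreover have "v = real (base_floor p u v) / real p ^ u" if "v \<ge> 0" "frac (real p ^ u * v) = 0" for v
      using that p_gt_1 by (simp add: base_floor_def frac_def field_simps)
    ultimately have "z \<in> lattice_lines"
      using xy unfolding z lattice_lines_def by fastforce
    then show ?thesis by simp
  qed
qed

end

theorem theorem1p9:
  fixes p :: nat
  assumes "prime p" and "odd p"
  shows "hausdorff_dim (cantor_F p) = ereal (ln ((real p ^ 2 + 1) / 2) / ln (real p))"
proof -
  interpret odd_base p
    using assms(2) prime_gt_1_nat[OF assms(1)] by unfold_locales
  have "2 * real K = real p ^ 2 + 1"
    using arg_cong[OF double_K, of real] by simp
  then have K: "real K = (real p ^ 2 + 1) / 2" by simp
  show ?thesis
    using hausdorff_dim_eqI[OF parity_set_subset_cantor_F[OF assms(1)] cantor_F_subset[OF assms(1)]]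
    unfolding dim_def K .
qed

end
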